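(* Let $F=\{f_i\}_{i=1}^N$ be a self-similar p.c.f. IFS (on a complete metric space) with dendrite attractor $K$. If $F$ satisfies the angle separation condition (ASC), then $\dim_C K=1$.
   Context: An iterated function system (IFS) $F=\{f_i\}_{i=1}^N$ is a finite family of contractions on a complete metric space $(X,d)$; it is self-similar if all $f_i$ are contractive similitudes. Its attractor is the unique nonempty compact $K$ with $K=\bigcup_{i=1}^N f_i(K)$, equipped with the metric $d$. Put $\Sigma=\{1,\dots,N\}$, $\Sigma^*=\bigcup_{k\ge1}\Sigma^k$, $f_{\omega_1\cdots\omega_k}=f_{\omega_1}\circ\cdots\circ f_{\omega_k}$. The coding map $\pi_K:\Sigma^\infty\to K$ is defined by $\{\pi_K(i_1i_2\cdots)\}=\bigcap_{k\ge1}f_{i_1\cdots i_k}(K)$. The critical set is $C_F=\bigcup_{i\ne j}f_i(K)\cap f_j(K)$ and the post-critical set is $P_F=\bigcup_{\omega\in\Sigma^*}\big(f_\omega^{-1}(C_F)\cap K\big)$. $F$ is post-critically finite (p.c.f.) if $\pi_K^{-1}(P_F)$ is finite. ASC: it is defined for IFS satisfying the single intersection condition (for all $i\ne j$, $f_i(K)\cap f_j(K)$ contains at most one point) and requires that there is $c>0$ such that whenever $i\neq j$ and $f_i(K)\cap f_j(K)=\{z\}$, one has $d(x,y)\ge c\max\{d(x,z),d(y,z)\}$ for all $x\in f_i(K)$, $y\in f_j(K)$. A dendrite is a locally connected continuum (compact connected space) containing no simple closed curve. A homeomorphism $h:(X,d_X)\to(Y,d_Y)$ is quasisymmetric if there is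 an increasing homeomorphism $\eta:[0,\infty)\to[0,\infty)$ such that for all $x,y,z\in X$ and $t\ge0$, $d_X(x,y)\le t\,d_X(x,z)$ implies $d_Y(h(x),h(y))\le\eta(t)\,d_Y(h(x),h(z))$; then the two spaces are called quasisymmetrically equivalent. The conformal dimension $\dim_C(X,d_X)$ is the infimum of the Hausdorff dimensions of all metric spaces $(Y,d_Y)$ quasisymmetrically equivalent to $(X,d_X)$.
   Formalization: The IFS is assumed to consist of at least two maps (N ≥ 2); for N = 1 the attractor is a single point, the other hypotheses hold trivially, and its conformal dimension is 0 rather than 1. *)

theory Defs
  imports "HOL-Analysis.Analysis"
begin

section \<open>Iterated function systems\<close>

text \<open>A system of \<open>N\<close> maps is given by \<open>f :: nat \<Rightarrow> 'a \<Rightarrow> 'a\<close>, of which only \<open>f 1, \<dots>, f N\<close> matter.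
  For a word \<open>w\<close>, given as a list, \<open>foldr f w\<close> is the composition \<open>f (w ! 0) \<circ> f (w ! 1) \<circ> \<dots>\<close>.\<close>

definition contractive_similitude :: "('a::metric_space \<Rightarrow> 'a) \<Rightarrow> bool" where
  "contractive_similitude g \<longleftrightarrow> (\<exists>r. 0 < r \<and> r < 1 \<and> (\<forall>x y. dist (g x) (g y) = r * dist x y))"

definition self_similar_ifs :: "nat \<Rightarrow> (nat \<Rightarrow> 'a::complete_space \<Rightarrow> 'a) \<Rightarrow> bool" where
  "self_similar_ifs N f \<longleftrightarrow> (\<forall>i\<in>{1..N}. contractive_similitude (f i))"

definition is_attractor :: "nat \<Rightarrow> (nat \<Rightarrow> 'a::complete_space \<Rightarrow> 'a) \<Rightarrow> 'a set \<Rightarrow> bool" where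
  "is_attractor N f K \<longleftrightarrow> K \<noteq> {} \<and> compact K \<and> K = (\<Union>i\<in>{1..N}. f i ` K)"

definition words :: "nat \<Rightarrow> nat list set" where
  "words N = {w. w \<noteq> [] \<and> set w \<subseteq> {1..N}}"

definition codes :: "nat \<Rightarrow> (nat \<Rightarrow> nat) set" where
  "codes N = {s. \<forall>n. s n \<in> {1..N}}"

definition coding_map :: "(nat \<Rightarrow> 'a \<Rightarrow> 'a) \<Rightarrow> 'a set \<Rightarrow> (nat \<Rightarrow> nat) \<Rightarrow> 'a" where
  "coding_map f K s = (THE x. {x} = (\<Inter>k\<in>{1..}. foldr f (map s [0..<k]) ` K))"

definition critical_set :: "nat \<Rightarrow> (nat \<Rightarrow> 'a \<Rightarrow> 'a) \<Rightarrow> 'a set \<Rightarrow> 'a set" where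
  "critical_set N f K = (\<Union>i\<in>{1..N}. \<Union>j\<in>{1..N} - {i}. f i ` K \<inter> f j ` K)"

definition post_critical_set :: "nat \<Rightarrow> (nat \<Rightarrow> 'a \<Rightarrow> 'a) \<Rightarrow> 'a set \<Rightarrow> 'a set" where
  "post_critical_set N f K = (\<Union>w\<in>words N. foldr f w -` critical_set N f K \<inter> K)"

definition post_critically_finite :: "nat \<Rightarrow> (nat \<Rightarrow> 'a \<Rightarrow> 'a) \<Rightarrow> 'a set \<Rightarrow> bool" where
  "post_critically_finite N f K \<longleftrightarrow>
     finite {s \<in> codes N. coding_map f K s \<in> post_critical_set N f K}"

definition single_intersection :: "nat \<Rightarrow> (nat \<Rightarrow> 'a \<Rightarrow> 'a) \<Rightarrow> 'a set \<Rightarrow> bool" where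
  "single_intersection N f K \<longleftrightarrow>
     (\<forall>i\<in>{1..N}. \<forall>j\<in>{1..N}. i \<noteq> j \<longrightarrow> f i ` K \<inter> f j ` K = {} \<or> (\<exists>z. f i ` K \<inter> f j ` K = {z}))"

definition angle_separation :: "nat \<Rightarrow> (nat \<Rightarrow> 'a::metric_space \<Rightarrow> 'a) \<Rightarrow> 'a set \<Rightarrow> bool" where
  "angle_separation N f K \<longleftrightarrow>
     single_intersection N f K \<and>
     (\<exists>c>0. \<forall>i\<in>{1..N}. \<forall>j\<in>{1..N}. \<forall>z. i \<noteq> j \<and> f i ` K \<inter> f j ` K = {z} \<longrightarrow>
        (\<forall>x \<in> f i ` K. \<forall>y \<in> f j ` K. dist x y \<ge> c * max (dist x z) (dist y z)))"


section \<open>Dendrites\<close>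

definition dendrite :: "'a::topological_space set \<Rightarrow> bool" where
  "dendrite K \<longleftrightarrow>
     K \<noteq> {} \<and> compact K \<and> connected K \<and> locally connected K \<and>
     \<not> (\<exists>g. simple_path g \<and> pathfinish g = pathstart g \<and> path_image g \<subseteq> K)"


section \<open>Hausdorff dimension\<close>

definition ediam :: "('a \<Rightarrow> 'a \<Rightarrow> real) \<Rightarrow> 'a set \<Rightarrow> ennreal" where
  "ediam d U = (SUP x\<in>U. SUP y\<in>U. ennreal (d x y))"

text \<open>The \<open>s\<close>-dimensional Hausdorff measure of the whole space \<open>(M, d)\<close>, meant for \<open>s > 0\<close>.
  Covering sets may be empty, so finite covers are included. \<open>enn2real\<close> is harmless since only sets
  of finite diameter are admitted.\<close>

definition hausdorff_measure :: "real \<Rightarrow> 'a set \<Rightarrow> ('a \<Rightarrow> 'a \<Rightarrow> real) \<Rightarrow> ennreal" where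
  "hausdorff_measure s M d =
     (SUP \<delta>\<in>{0<..}.
        INF U\<in>{U :: nat \<Rightarrow> 'a set. (\<Union>n. U n) = M \<and> (\<forall>n. ediam d (U n) \<le> ennreal \<delta>)}.
          \<Sum>n. ennreal (enn2real (ediam d (U n)) powr s))"

text \<open>Leaving out \<open>s = 0\<close> avoids the convention for \<open>0\<^sup>0\<close> and does not change the infimum.\<close>

definition hausdorff_dim :: "'a set \<Rightarrow> ('a \<Rightarrow> 'a \<Rightarrow> real) \<Rightarrow> ennreal" where
  "hausdorff_dim M d = Inf {ennreal s |s. s > 0 \<and> hausdorff_measure s M d = 0}"


section \<open>Quasisymmetry and conformal dimension\<close>

definition quasisymmetric ::
  "'a set \<Rightarrow> ('a \<Rightarrow> 'a \<Rightarrow> real) \<Rightarrow> 'b set \<Rightarrow> ('b \<Rightarrow> 'b \<Rightarrow> real) \<Rightarrow> ('a \<Rightarrow> 'b) \<Rightarrow> bool" where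
  "quasisymmetric X dX Y dY h \<longleftrightarrow>
     homeomorphic_map (Metric_space.mtopology X dX) (Metric_space.mtopology Y dY) h \<and>
     (\<exists>\<eta> :: real \<Rightarrow> real. strict_mono_on {0..} \<eta> \<and> (\<exists>\<eta>'. homeomorphism {0..} {0..} \<eta> \<eta>') \<and>
        (\<forall>x\<in>X. \<forall>y\<in>X. \<forall>z\<in>X. \<forall>t\<ge>0. dX x y \<le> t * dX x z \<longrightarrow> dY (h x) (h y) \<le> \<eta> t * dY (h x) (h z)))"

definition qs_equivalent ::
  "'a set \<Rightarrow> ('a \<Rightarrow> 'a \<Rightarrow> real) \<Rightarrow> 'b set \<Rightarrow> ('b \<Rightarrow> 'b \<Rightarrow> real) \<Rightarrow> bool" where
  "qs_equivalent X dX Y dY \<longleftrightarrow> (\<exists>h. quasisymmetric X dX Y dY h)"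

text \<open>The infimum ranges over the metric spaces whose points are of the same type as those of \<open>X\<close>.
  This is no restriction: a space \<open>Y\<close> over any type that is quasisymmetrically equivalent to \<open>X\<close>
  is in bijection with \<open>X\<close>, hence isometric to a space with point set \<open>X\<close>; see
  \<open>conformal_dim_le\<close> below.\<close>

definition conformal_dim :: "'a set \<Rightarrow> ('a \<Rightarrow> 'a \<Rightarrow> real) \<Rightarrow> ennreal" where
  "conformal_dim X dX =
     Inf {hausdorff_dim Y dY |(Y :: 'a set) dY. Metric_space Y dY \<and> qs_equivalent X dX Y dY}"

lemma hausdorff_measure_pullback:
  assumes "bij_betw h X Y"
  shows "hausdorff_measure s X (\<lambda>x y. d (h x) (h y)) = hausdorff_measure s Y d"
proof -
  define d' where "d' = (\<lambda>x y. d (h x) (h y))"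
  define g where "g = inv_into X h"
  have diam: "ediam d' U = ediam d (h ` U)" for U
    by (simp add: ediam_def d'_def image_image)
  have hg: "h ` (g ` V) = V" if "V \<subseteq> Y" for V
    using that assms by (force simp: g_def bij_betw_def f_inv_into_f image_image subset_iff)
  have hX: "h ` X = Y" and gY: "g ` Y = X"
    using assms bij_betw_inv_into[OF assms] by (auto simp: bij_betw_def g_def)
  let ?c = "\<lambda>d U. \<Sum>n. ennreal (enn2real (ediam d (U n)) powr s)"
  let ?C = "\<lambda>X d \<delta>. {U :: nat \<Rightarrow> _. (\<Union>n. U n) = X \<and> (\<forall>n. ediam d (U n) \<le> ennreal \<delta>)}"
  have "?c d' ` ?C X d' \<delta> = ?c d ` ?C Y d \<delta>" for \<delta>
  proof (intro equalityI subsetI)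
    fix v assume "v \<in> ?c d' ` ?C X d' \<delta>"
    then obtain U where U: "U \<in> ?C X d' \<delta>" "v = ?c d' U" by blast
    have "(\<lambda>n. h ` U n) \<in> ?C Y d \<delta>"
      using U(1) hX by (auto simp: diam simp flip: image_UN)
    have "v = ?c d (\<lambda>n. h ` U n)"
      using U(2) by (simp add: diam)
    show "v \<in> ?c d ` ?C Y d \<delta>" by (rule image_eqI) fact+
  next
    fix v assume "v \<in> ?c d ` ?C Y d \<delta>"
    then obtain V where V: "V \<in> ?C Y d \<delta>" "v = ?c d V" by blast
    have sub: "V n \<subseteq> Y" for n using V(1) by blast
    have "(\<lambda>n. g ` V n) \<in> ?C X d' \<delta>"
      using V(1) gY by (auto simp: diam hg[OF sub] simp flip: image_UN)
    have "v = ?c d' (\<lambda>n. g ` V n)"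
      using V(2) by (simp add: diam hg[OF sub])
    show "v \<in> ?c d' ` ?C X d' \<delta>" by (rule image_eqI) fact+
  qed
  then show ?thesis
    by (simp add: hausdorff_measure_def flip: d'_def)
qed

lemma conformal_dim_le:
  fixes X :: "'a set" and Y :: "'b set"
  assumes X: "Metric_space X dX" and Y: "Metric_space Y dY" and "qs_equivalent X dX Y dY"
  shows "conformal_dim X dX \<le> hausdorff_dim Y dY"
proof -
  obtain h where h: "quasisymmetric X dX Y dY h"
    using assms(3) by (auto simp: qs_equivalent_def)
  define d' where "d' = (\<lambda>x y. dY (h x) (h y))"
  interpret MX: Metric_space X dX by fact
  interpret MY: Metric_space Y dY by fact
  have homeo: "homeomorphic_map MX.mtopology MY.mtopology h"
    using h by (simp add: quasisymmetric_def)
  then have bij: "bij_betw h X Y"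
    using homeomorphic_imp_surjective_map[OF homeo] homeomorphic_imp_injective_map[OF homeo]
    by (simp add: bij_betw_def)
  have hY: "h x \<in> Y" if "x \<in> X" for x using bij that by (auto simp: bij_betw_def)
  have inj: "h x = h y \<longleftrightarrow> x = y" if "x \<in> X" "y \<in> X" for x y
    using bij that by (auto simp: bij_betw_def inj_on_def)
  have M': "Metric_space X d'"
    by unfold_locales (auto simp: d'_def hY inj MY.commute intro: MY.triangle)
  interpret M2: Metric_space12 X d' Y dY
    by (simp add: Metric_space12_def M' Y)
  have iso: "homeomorphic_map M2.M1.mtopology MY.mtopology h"
    by (rule M2.isometry_imp_homeomorphic_map) (use bij in \<open>auto simp: d'_def bij_betw_def\<close>)
  obtain g where g: "homeomorphic_maps M2.M1.mtopology MY.mtopology h g"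
    using iso by (auto simp: homeomorphic_map_maps)
  have "homeomorphic_map MY.mtopology M2.M1.mtopology g"
    using g homeomorphic_maps_map homeomorphic_maps_sym by blast
  then have "homeomorphic_map MX.mtopology M2.M1.mtopology (g \<circ> h)"
    using homeo homeomorphic_map_compose by blast
  moreover have "(g \<circ> h) x = x" if "x \<in> X" for x
    using g that by (auto simp: homeomorphic_maps_def)
  ultimately have "homeomorphic_map MX.mtopology M2.M1.mtopology id"
    using homeomorphic_map_eq[of MX.mtopology M2.M1.mtopology "g \<circ> h" id] by simp
  then have "quasisymmetric X dX X d' id"
    using h by (simp add: quasisymmetric_def d'_def)
  then have "conformal_dim X dX \<le> hausdorff_dim X d'"
    unfolding conformal_dim_def qs_equivalent_def using M' by (blast intro: Inf_lower)
  also have "hausdorff_dim X d' = hausdorff_dim Y dY"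
    using hausdorff_measure_pullback[OF bij] by (simp add: hausdorff_dim_def d'_def)
  finally show ?thesis .
qed

end

theory Submission
  imports Defs "HOL-Library.Sublist" "HOL-Real_Asymp.Real_Asymp"
begin

text \<open>
  Fix \<open>s > 1\<close> and let \<open>P\<close> be the post-critical set. Each post-critical point \<open>a\<close> is surrounded by
  annuli made of boundedly many cells, and \<open>ln (dist x a)\<close> varies by a bounded amount over each of
  these cells. Cut \<open>K\<close> into the level \<open>n\<close> cells that meet \<open>P\<close> and the maximal cells of level at most
  \<open>n\<close> that miss \<open>P\<close>. The latter are \<open>O(n)\<close> in number and receive a weight of order \<open>1/n\<close>, just
  enough for every chain of cells between two points of \<open>P\<close> to have total weight at least 1; the
  former, boundedly many, keep their contraction ratio as weight. The sum of the \<open>s\<close>-th powers of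
  the weights tends to 0 as \<open>n\<close> grows, so it is less than 1 for a suitable \<open>n\<close>.

  Extend the weights multiplicatively to words and let \<open>D\<close> be the largest pseudometric in which every
  cell has diameter at most its weight. Then \<open>D\<close> is comparable to the original metric seen from a
  point of \<open>P\<close>, and angle separation carries this over to the points where two cells meet. It
  follows that \<open>D x y\<close> is comparable to the weight of any cell at \<open>x\<close> whose size is comparable to
  \<open>dist x y\<close>. Hence the identity is quasisymmetric from \<open>dist\<close> to \<open>D\<close>, and \<open>D\<close> has Hausdorff
  dimension at most \<open>s\<close>.

  Conversely, every space homeomorphic to \<open>K\<close> is connected with more than one point, and the distance
  from one of its points maps it onto a nondegenerate interval without increasing distances.
\<close>

text \<open>Cells of comparable size on the two sides of a meeting point must get comparable
  weights, or the new metric is not quasisymmetric to the old one. An arbitrary multiplicative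
  weight decays along each side of such a point at its own rate. The preimages of the point lie in
  \<open>P\<close>, so keeping \<open>ratio\<close> as the weight of cells that meet
  \<open>P\<close> makes both rates agree with that of the original metric. Only the cells that miss
  \<open>P\<close> are free, and for them a logarithmic cutoff is used: about n cells of weight 1/n
  have s-th powers of total order n^(1-s), which tends to 0 exactly for s > 1. This is the discrete
  form of the vanishing capacity of a point. A sum below 1 at the first level suffices, because
  weights multiply along words and the sum at level k is its k-th power. Defining \<open>D\<close>
  by test functions instead of chains turns a lower bound into the construction of one function,
  which is why interpolation appears.\<close>

section \<open>Cells of systems of similitudes\<close>

text \<open>Left active, these rules unfold \<open>w \<in> lists I\<close> into a statement about
  \<open>set w\<close>, and the lemmas below no longer match.\<close>

declare in_listsD [rule del] in_listsI [rule del]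

text \<open>The index type is arbitrary because the locale serves both the given maps and
  compositions of them, with words as letters.\<close>

locale similitude_ifs =
  fixes I :: "'i set" and g :: "'i \<Rightarrow> 'a::metric_space \<Rightarrow> 'a" and r :: "'i \<Rightarrow> real"
    and K :: "'a set"
  assumes finI: "finite I"
    and r_pos: "i \<in> I \<Longrightarrow> 0 < r i"
    and r_less_1: "i \<in> I \<Longrightarrow> r i < 1"
    and dist_g: "i \<in> I \<Longrightarrow> dist (g i x) (g i y) = r i * dist x y"
    and K_ne: "K \<noteq> {}" and K_compact: "compact K" and K_eq: "K = (\<Union>i\<in>I. g i ` K)"
begin

section \<open>Ratios and cells of words\<close>

definition ratio :: "'i list \<Rightarrow> real" where "ratio w = prod_list (map r w)"

definition cell :: "'i list \<Rightarrow> 'a set" where "cell w = foldr g w ` K"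

lemma ratio_simps [simp]: "ratio [] = 1" "ratio (i # w) = r i * ratio w" "ratio (u @ v) =
    ratio u * ratio v"
  by (auto simp: ratio_def)

lemma ratio_pos: "w \<in> lists I \<Longrightarrow> 0 < ratio w"
  by (induction w) (auto simp: r_pos)

lemma ratio_le_1: "w \<in> lists I \<Longrightarrow> ratio w \<le> 1"
proof (induction w)
  case (Cons i w)
  then show ?case using r_less_1[of i] r_pos[of i] ratio_pos[of w] by (auto intro!: mult_le_one)
qed auto

lemma dist_foldr: "w \<in> lists I \<Longrightarrow> dist (foldr g w x) (foldr g w y) = ratio w * dist x y"
  by (induction w) (auto simp: dist_g)

lemma foldr_inj: "w \<in> lists I \<Longrightarrow> foldr g w x = foldr g w y \<Longrightarrow> x = y"
  using dist_foldr[of w x y] ratio_pos[of w] by auto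

lemma g_inj: "i \<in> I \<Longrightarrow> g i x = g i y \<Longrightarrow> x = y"
  using foldr_inj[of "[i]"] by auto

lemma g_in_K: "i \<in> I \<Longrightarrow> x \<in> K \<Longrightarrow> g i x \<in> K"
  using K_eq by blast

lemma foldr_in_K: "w \<in> lists I \<Longrightarrow> x \<in> K \<Longrightarrow> foldr g w x \<in> K"
  by (induction w) (auto simp: g_in_K)

lemma cell_Nil [simp]: "cell [] = K"
  by (simp add: cell_def)

lemma foldr_in_cell [intro]: "x \<in> K \<Longrightarrow> foldr g w x \<in> cell w"
  by (auto simp: cell_def)

lemma cell_append: "cell (u @ v) = foldr g u ` cell v"
  by (auto simp: cell_def image_comp)

lemma cell_subset_K: "w \<in> lists I \<Longrightarrow> cell w \<subseteq> K"
  by (auto simp: cell_def foldr_in_K)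

lemma cell_append_subset: "v \<in> lists I \<Longrightarrow> cell (u @ v) \<subseteq> cell u"
  unfolding cell_append using cell_subset_K[of v] by (auto simp: cell_def)

lemma foldr_in_cell_append_iff:
  "u \<in> lists I \<Longrightarrow> foldr g u x \<in> cell (u @ v) \<longleftrightarrow> x \<in> cell v"
  unfolding cell_append using foldr_inj by blast

lemma cell_cover:
  assumes "x \<in> cell w" "w \<in> lists I"
  obtains i where "i \<in> I" "x \<in> cell (w @ [i])"
proof -
  obtain y where y: "y \<in> K" "x = foldr g w y" using assms(1) by (auto simp: cell_def)
  then obtain i z where "i \<in> I" "z \<in> K" "y = g i z" using K_eq by blast
  then show ?thesis using that[of i] y by (auto simp: cell_def)
qed

lemma cell_compact: "w \<in> lists I \<Longrightarrow> compact (cell w)"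
  unfolding cell_def
proof (rule compact_continuous_image[OF _ K_compact])
  assume w: "w \<in> lists I"
  show "continuous_on K (foldr g w)"
    unfolding continuous_on_iff
  proof (intro ballI allI impI)
    fix x and e :: real assume "x \<in> K" "0 < e"
    then show "\<exists>d>0. \<forall>x'\<in>K. dist x' x < d \<longrightarrow> dist (foldr g w x') (foldr g w x) < e"
      using dist_foldr[OF w] ratio_pos[OF w]
      by (intro exI[of _ "e / ratio w"]) (auto simp: field_simps)
  qed
qed

text \<open>The summand 1 makes the constant at least 1, so that \<open>ratio w\<close> is itself
  bounded by \<open>diam_bound * ratio w\<close>.\<close>

definition diam_bound :: real where "diam_bound = diameter K + 1"

lemma diam_bound_ge_1: "1 \<le> diam_bound"
  using diameter_ge_0[OF compact_imp_bounded[OF K_compact]] by (simp add: diam_bound_def)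

lemma diam_bound_pos: "0 < diam_bound" using diam_bound_ge_1 by simp

lemma dist_K: "x \<in> K \<Longrightarrow> y \<in> K \<Longrightarrow> dist x y \<le> diam_bound"
  using diameter_bounded_bound[OF compact_imp_bounded[OF K_compact], of x y]
    by (simp add: diam_bound_def)

lemma dist_cell: "w \<in> lists I \<Longrightarrow> x \<in> cell w \<Longrightarrow> y \<in> cell w \<Longrightarrow> dist x y \<le> diam_bound * ratio w"
  using dist_K ratio_pos[of w]
  by (auto simp: cell_def dist_foldr mult.commute[of diam_bound])

section \<open>Cells of prescribed size\<close>

lemma I_ne: "I \<noteq> {}"
  using K_eq K_ne by blast

definition rmax :: real where "rmax = Max (r ` I)"
definition rmin :: real where "rmin = Min (r ` I)"

lemma rmax: "0 < rmax" "rmax < 1" "i \<in> I \<Longrightarrow> r i \<le> rmax"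
  using finI I_ne r_pos r_less_1 by (auto simp: rmax_def Max_gr_iff)

lemma rmin: "0 < rmin" "rmin < 1" "i \<in> I \<Longrightarrow> rmin \<le> r i"
  using finI I_ne r_pos r_less_1 by (auto simp: rmin_def Min_less_iff)

lemma ratio_le_power: "w \<in> lists I \<Longrightarrow> ratio w \<le> rmax ^ length w"
proof (induction w)
  case (Cons i w)
  then show ?case using rmax[of] r_pos[of i] ratio_pos[of w] by (auto intro!: mult_mono rmax)
qed auto

lemma cell_extend_length:
  assumes "x \<in> cell w" "w \<in> lists I"
  shows "\<exists>v\<in>lists I. length v = n \<and> x \<in> cell (w @ v)"
proof (induction n)
  case 0
  then show ?case using assms by auto
next
  case (Suc n)
  then obtain v where v: "v \<in> lists I" "length v = n" "x \<in> cell (w @ v)" by blast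
  then obtain i where "i \<in> I" "x \<in> cell ((w @ v) @ [i])"
    using cell_cover[of x "w @ v"] assms by auto
  then show ?case using v by (intro bexI[of _ "v @ [i]"]) auto
qed

text \<open>The shortest extension of ratio at most \<open>s\<close> will do: one letter earlier the
  ratio exceeds \<open>s\<close>, and a letter loses at most the factor \<open>rmin\<close>.\<close>

lemma cell_extend:
  assumes x: "x \<in> cell w" and w: "w \<in> lists I" and s: "0 < s" "s \<le> ratio w"
  obtains v where "v \<in> lists I" "x \<in> cell (w @ v)" "rmin * s \<le> ratio (w @ v)" "ratio (w @ v) \<le> s"
proof -
  define Q where "Q = (\<lambda>v. v \<in> lists I \<and> x \<in> cell (w @ v) \<and> ratio (w @ v) \<le> s)"
  obtain n where n: "rmax ^ n < s"
    using real_arch_pow_inv[OF s(1) rmax(2)] by blast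
  obtain v0 where v0: "v0 \<in> lists I" "length v0 = n" "x \<in> cell (w @ v0)"
    using cell_extend_length[OF x w] by blast
  have "ratio (w @ v0) \<le> ratio v0"
    using ratio_le_1[OF w] ratio_pos[OF v0(1)] ratio_pos[OF w] by (simp add: mult_left_le_one_le)
  then have "ratio (w @ v0) \<le> s"
    using ratio_le_power[OF v0(1)] v0(2) n by simp
  then have "Q v0" using v0 by (simp add: Q_def)
  then obtain v where v: "Q v" and min: "\<And>v'. Q v' \<Longrightarrow> length v \<le> length v'"
    using ex_has_least_nat[of Q v0 length] by blast
  have "rmin * s \<le> ratio (w @ v)"
  proof (cases v rule: rev_cases)
    case Nil
    then show ?thesis using s v rmin(1,2)
      using mult_left_le_one_le[of s rmin] by (simp add: Q_def)
  next
    case (snoc u i)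
    then have ui: "u \<in> lists I" "i \<in> I" using v by (auto simp: Q_def)
    have "x \<in> cell (w @ u)"
      using v cell_append_subset[of "[i]" "w @ u"] ui snoc by (auto simp: Q_def)
    moreover have "\<not> Q u" using min[of u] snoc by auto
    ultimately have "s < ratio (w @ u)" using ui by (auto simp: Q_def)
    then have "rmin * s \<le> r i * ratio (w @ u)"
      using rmin s ui r_pos[of i] by (intro mult_mono) auto
    then show ?thesis using snoc by (simp add: mult_ac)
  qed
  then show ?thesis using that v by (auto simp: Q_def)
qed

text \<open>Compactness settles one pair of cells, finiteness of \<open>I\<close> all pairs at
  once.\<close>

lemma dist_disjoint_cells:
  "\<exists>\<delta>>0. \<forall>i\<in>I. \<forall>j\<in>I. cell [i] \<inter> cell [j] = {} \<longrightarrow> (\<forall>x\<in>cell [i]. \<forall>y\<in>cell [j]. \<delta> \<le> dist x y)"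
proof -
  have "\<exists>c>0. cell [i] \<inter> cell [j] = {} \<longrightarrow> (\<forall>x\<in>cell [i]. \<forall>y\<in>cell [j]. c \<le> dist x y)"
    if "i \<in> I" "j \<in> I" for i j
  proof (cases "cell [i] \<inter> cell [j] = {}")
    case True
    have "compact (cell [i])" "closed (cell [j])"
      using that cell_compact[of "[i]"] cell_compact[of "[j]"] by (auto intro: compact_imp_closed)
    moreover have "cell [i] \<noteq> {}" "cell [j] \<noteq> {}" using K_ne by (auto simp: cell_def)
    moreover have "continuous_on (cell [i]) (\<lambda>x. infdist x (cell [j]))"
      by (intro continuous_intros)
    ultimately obtain z where z: "z \<in> cell [i]"
        "\<forall>x\<in>cell [i]. infdist z (cell [j]) \<le> infdist x (cell [j])"
      using continuous_attains_inf by blast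
    have "z \<notin> cell [j]" using z True by blast
    then have "infdist z (cell [j]) > 0"
      using infdist_pos_not_in_closed \<open>closed (cell [j])\<close> \<open>cell [j] \<noteq> {}\<close> by blast
    then show ?thesis using z infdist_le order_trans by metis
  qed (auto intro: exI[of _ 1])
  then obtain c where c: "\<And>i j. i \<in> I \<Longrightarrow> j \<in> I \<Longrightarrow> c i j > 0"
     "\<And>i j x y. i \<in> I \<Longrightarrow> j \<in> I \<Longrightarrow> cell [i] \<inter> cell [j] = {} \<Longrightarrow> x \<in> cell [i] \<Longrightarrow> y \<in> cell [j] \<Longrightarrow>
         c i j \<le> dist x y" by metis
  define C where "C = Min (insert 1 ((\<lambda>(i,j). c i j) ` (I \<times> I)))"
  have "C > 0" and "\<And>i j. i \<in> I \<Longrightarrow> j \<in> I \<Longrightarrow> C \<le> c i j"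
    using c finI by (auto simp: C_def intro!: Min_le)
  then show ?thesis using c(2) by (intro exI[of _ C]) (meson order_trans)
qed

subsection \<open>Codes\<close>

text \<open>Prescribing the initial word \<open>w\<close> is what later assigns different codes to
  different cells of one level and so bounds the number of cells that meet \<open>P\<close>.\<close>

lemma code_exists:
  assumes x: "x \<in> cell w" and w: "w \<in> lists I"
  obtains s where "\<And>n. s n \<in> I" "map s [0..<length w] = w" "\<And>k. x \<in> cell (map s [0..<k])"
proof -
  define h where "h = (\<lambda>u. SOME i. i \<in> I \<and> x \<in> cell (u @ [i]))"
  have h: "h u \<in> I \<and> x \<in> cell (u @ [h u])" if "u \<in> lists I" "x \<in> cell u" for u
    unfolding h_def by (rule someI_ex) (use cell_cover[OF that(2,1)] in blast)
  define W where "W = (\<lambda>n. ((\<lambda>u. u @ [h u]) ^^ n) w)"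
  have W_Suc: "W (Suc n) = W n @ [h (W n)]" for n by (simp add: W_def)
  have W: "W n \<in> lists I \<and> x \<in> cell (W n) \<and> length (W n) = length w + n" for n
  proof (induction n)
    case 0
    then show ?case using x w by (simp add: W_def)
  next
    case (Suc n)
    then show ?case using h[of "W n"] by (simp add: W_Suc)
  qed
  have prefix: "\<exists>v. W (n + m) = W n @ v" for n m
    by (induction m) (auto simp: W_Suc)
  \<comment> \<open>\<open>W (Suc n)\<close> has more than \<open>n\<close> letters whatever the
    length of \<open>w\<close>, so the index is valid.\<close>
  define s where "s = (\<lambda>n. W (Suc n) ! n)"
  have s_take: "map s [0..<k] = take k (W k)" for k
  proof (rule nth_equalityI)
    fix n assume "n < length (map s [0..<k])"
    then have n: "n < k" by simp
    then obtain v where "W k = W (Suc n) @ v" using prefix[of "Suc n" "k - Suc n"] by auto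
    then have "W k ! n = W (Suc n) ! n" using W[of "Suc n"] by (simp add: nth_append)
    then show "map s [0..<k] ! n = take k (W k) ! n" using n by (simp add: s_def)
  qed (use W in auto)
  show ?thesis
  proof
    show "s n \<in> I" for n
      using W[of "Suc n"] nth_mem[of n "W (Suc n)"] by (auto simp: s_def in_lists_conv_set)
    obtain v where "W (length w) = w @ v" using prefix[of 0 "length w"] by (auto simp: W_def)
    then show "map s [0..<length w] = w" by (simp add: s_take)
    fix k
    have "W k = take k (W k) @ drop k (W k)" by simp
    moreover have "drop k (W k) \<in> lists I" using W[of k] in_set_dropD
      by (force simp: in_lists_conv_set)
    ultimately have "cell (W k) \<subseteq> cell (take k (W k))" using cell_append_subset by metis
    then show "x \<in> cell (map s [0..<k])" using W[of k] by (auto simp: s_take)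
  qed
qed

text \<open>Evaluates the definite description in \<open>coding_map\<close>; the diameters of the
  cells decrease geometrically.\<close>

lemma INT_cells_code:
  assumes s: "\<And>n. s n \<in> I" and x: "\<And>k. x \<in> cell (map s [0..<k])"
  shows "(\<Inter>k\<in>{1..}. cell (map s [0..<k])) = {x}"
  proof (intro equalityI subsetI)
    fix y assume y: "y \<in> (\<Inter>k\<in>{1..}. cell (map s [0..<k]))"
    have "dist x y \<le> diam_bound * rmax ^ k" if "1 \<le> k" for k
    proof -
      have w: "map s [0..<k] \<in> lists I" using s by (auto simp: in_lists_conv_set)
      have "y \<in> cell (map s [0..<k])" using y that by auto
      then have "dist x y \<le> diam_bound * ratio (map s [0..<k])" using dist_cell[OF w] x by blast
      also have "\<dots> \<le> diam_bound * rmax ^ k"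
        using ratio_le_power[OF w] diam_bound_pos by (intro mult_left_mono) auto
      finally show ?thesis .
    qed
    then have "eventually (\<lambda>k. dist x y \<le> diam_bound * rmax ^ k) sequentially"
      by (auto simp: eventually_sequentially)
    moreover have "(\<lambda>k. diam_bound * rmax ^ k) \<longlonglongrightarrow> diam_bound * 0"
      using rmax(1,2) by (intro tendsto_intros LIMSEQ_power_zero) auto
    ultimately have "dist x y \<le> diam_bound * 0"
      using tendsto_lowerbound trivial_limit_sequentially by blast
    then show "y \<in> {x}" by simp
  next
    fix y assume "y \<in> {x}"
    then show "y \<in> (\<Inter>k\<in>{1..}. cell (map s [0..<k]))" using x by auto
  qed

end

subsection \<open>The post-critical set\<close>

text \<open>All that is used of the post-critical set \<open>P\<close> is that it is finite, closed under preimages of the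
  maps, and contains the preimages of the points where two cells meet. In this form the hypotheses
  pass to the systems of longer words considered below.\<close>

locale similitude_system = similitude_ifs I g r K
  for I :: "'i set" and g :: "'i \<Rightarrow> 'a::metric_space \<Rightarrow> 'a" and r :: "'i \<Rightarrow> real" and K :: "'a set" +
  fixes P :: "'a set" and c :: real
  assumes finP: "finite P" and PK: "P \<subseteq> K"
    and P_back: "\<lbrakk>i \<in> I; x \<in> K; g i x \<in> P\<rbrakk> \<Longrightarrow> x \<in> P"
    and P_meet: "\<lbrakk>i \<in> I; j \<in> I; i \<noteq> j; x \<in> K; y \<in> K; g i x = g j y\<rbrakk> \<Longrightarrow> x \<in> P"
    and c_pos: "0 < c"
    and separation: "\<lbrakk>i \<in> I; j \<in> I; i \<noteq> j; z \<in> g i ` K; z \<in> g j ` K; x \<in> g i ` K; y \<in> g j ` K\<rbrakk>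
        \<Longrightarrow> c * dist x z \<le> dist x y"
begin

lemma P_back_word: "w \<in> lists I \<Longrightarrow> x \<in> K \<Longrightarrow> foldr g w x \<in> P \<Longrightarrow> x \<in> P"
  by (induction w) (auto intro: P_back foldr_in_K)

text \<open>Injectivity cancels the common prefix \<open>u\<close>. What remains is a point in two
  first level cells, and its preimage is pulled back through \<open>v\<close>.\<close>

lemma P_meet_word:
  assumes "u @ i # v \<in> lists I" "u @ j # w \<in> lists I" "i \<noteq> j" "x \<in> K" "y \<in> K"
    and "foldr g (u @ i # v) x = foldr g (u @ j # w) y"
  shows "x \<in> P"
proof -
  have "g i (foldr g v x) = g j (foldr g w y)"
    using assms foldr_inj[of u] by auto
  then have "foldr g v x \<in> P"
    using P_meet[of i j] assms foldr_in_K by auto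
  then show ?thesis using P_back_word assms by auto
qed

text \<open>Similitudes scale both sides by \<open>ratio u\<close>, so one constant serves all
  levels.\<close>

lemma separation_cells:
  assumes "u \<in> lists I" "i \<in> I" "j \<in> I" "i \<noteq> j" "z \<in> cell (u @ [i])" "z \<in> cell (u @ [j])"
    "x \<in> cell (u @ [i])" "y \<in> cell (u @ [j])"
  shows "c * dist x z \<le> dist x y"
proof -
  from assms obtain z' x' y' where *: "z' \<in> g i ` K" "z = foldr g u z'" "x' \<in> g i ` K" "x =
      foldr g u x'"
    "y' \<in> g j ` K" "y = foldr g u y'"
    by (auto simp: cell_append) (auto simp: cell_def)
  moreover have "z' \<in> g j ` K"
    using assms(6,1) * foldr_in_cell_append_iff[of u z' "[j]"] by (auto simp: cell_def)
  ultimately have "c * dist x' z' \<le> dist x' y'"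
    using separation assms(2-4) by blast
  then have "ratio u * (c * dist x' z') \<le> ratio u * dist x' y'"
    using ratio_pos[OF assms(1)] by (intro mult_left_mono) auto
  then show ?thesis using * dist_foldr[OF assms(1)] by (simp add: mult_ac)
qed

text \<open>Take the longest prefix \<open>u\<close> of \<open>w\<close> whose cell contains
  \<open>a\<close>. Rescaled by \<open>u\<close>, the point \<open>a\<close> becomes a point of
  \<open>P\<close> outside the first level cell given by the next letter, and only finitely many
  such pairs exist.\<close>

lemma dist_P_cell:
  "\<exists>c>0. \<forall>a\<in>P. \<forall>w\<in>lists I. \<forall>x\<in>cell w. a \<notin> cell w \<longrightarrow>
     (\<exists>u v. w = u @ v \<and> v \<noteq> [] \<and> a \<in> cell u \<and> c * ratio u \<le> dist a x)"
proof -
  have one: "\<exists>c>0. \<forall>x\<in>cell [i]. a \<notin> cell [i] \<longrightarrow> c \<le> dist a x" if "i \<in> I" for i a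
  proof (cases "a \<in> cell [i]")
    case False
    have "closed (cell [i])" by (rule compact_imp_closed[OF cell_compact]) (use that in simp)
    moreover have "cell [i] \<noteq> {}" using K_ne by (simp add: cell_def)
    ultimately have "infdist a (cell [i]) > 0" using infdist_pos_not_in_closed False by blast
    then show ?thesis using infdist_le by blast
  qed (auto intro: exI[of _ 1])
  then obtain c where c: "\<And>i a. i \<in> I \<Longrightarrow> c i a > 0"
     "\<And>i a x. i \<in> I \<Longrightarrow> x \<in> cell [i] \<Longrightarrow> a \<notin> cell [i] \<Longrightarrow> c i a \<le> dist a x" by metis
  \<comment> \<open>The element 1 keeps the minimum defined when \<open>P\<close> is empty.\<close>
  define C where "C = Min (insert 1 ((\<lambda>(i,a). c i a) ` (I \<times> P)))"
  have Cpos: "C > 0" and Cle: "\<And>i a. i \<in> I \<Longrightarrow> a \<in> P \<Longrightarrow> C \<le> c i a"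
    using c finI finP by (auto simp: C_def intro!: Min_le)
  show ?thesis
  proof (intro exI[of _ C] conjI ballI impI Cpos)
    fix a w x assume a: "a \<in> P" and w: "w \<in> lists I" and x: "x \<in> cell w" and na: "a \<notin> cell w"
    define Q where "Q = (\<lambda>u. prefix u w \<and> a \<in> cell u)"
    have "Q []" using a PK by (auto simp: Q_def)
    moreover have "\<forall>u. Q u \<longrightarrow> length u < Suc (length w)"
      by (auto simp: Q_def le_imp_less_Suc prefix_length_le)
    ultimately obtain u where u: "Q u" and max: "\<And>u'. Q u' \<Longrightarrow> length u' \<le> length u"
      using ex_has_greatest_nat[of Q "[]" length "Suc (length w)"] by auto
    obtain v where v: "w = u @ v" using u by (auto simp: Q_def prefix_def)
    have "v \<noteq> []" using v u na by (auto simp: Q_def)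
    then obtain i v' where iv: "v = i # v'" by (cases v) auto
    have mem: "u \<in> lists I" "i \<in> I" "v' \<in> lists I" using w v iv by auto
    have "\<not> Q (u @ [i])" using max[of "u @ [i]"] by auto
    then have na': "a \<notin> cell (u @ [i])" using v iv by (auto simp: Q_def)
    have "a \<in> cell u" using u by (simp add: Q_def)
    then obtain a' where a': "a' \<in> K" "a = foldr g u a'" by (auto simp: cell_def)
    have a'P: "a' \<in> P" using P_back_word[OF mem(1) a'(1)] a a' by simp
    have "x \<in> cell (u @ [i])" using x v iv cell_append_subset[of v' "u @ [i]"] mem by auto
    then obtain x' where x': "x' \<in> cell [i]" "x = foldr g u x'" by (auto simp: cell_append)
    have "a' \<notin> cell [i]" using na' a' foldr_in_cell_append_iff[OF mem(1)] by auto
    then have "C \<le> dist a' x'" using c(2)[OF mem(2) x'(1)] Cle[OF mem(2) a'P] by fastforce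
    then have "C * ratio u \<le> dist a x"
      using a' x' dist_foldr[OF mem(1)] ratio_pos[OF mem(1)] by (simp add: mult.commute)
    then show "\<exists>u v. w = u @ v \<and> v \<noteq> [] \<and> a \<in> cell u \<and> C * ratio u \<le> dist a x"
      using v \<open>v \<noteq> []\<close> \<open>a \<in> cell u\<close> by blast
  qed
qed

end

section \<open>The metric defined by a weight\<close>

text \<open>\<open>\<theta> a\<close> is a cutoff function around the post-critical point \<open>a\<close>; the existence of such cutoffs
  expresses that crossing \<open>K\<close> between two points of \<open>P\<close> costs weight at least 1.\<close>

locale weighted_system = similitude_system I g r K P c
  for I :: "'i set" and g :: "'i \<Rightarrow> 'a::metric_space \<Rightarrow> 'a" and r :: "'i \<Rightarrow> real"
    and K P :: "'a set" and c :: real +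
  fixes \<rho> :: "'i \<Rightarrow> real" and \<theta> :: "'a \<Rightarrow> 'a \<Rightarrow> real" and p0 :: 'a
  assumes rho_pos: "i \<in> I \<Longrightarrow> 0 < \<rho> i"
    and rho_less_1: "i \<in> I \<Longrightarrow> \<rho> i < 1"
    and rho_P: "\<lbrakk>i \<in> I; g i ` K \<inter> P \<noteq> {}\<rbrakk> \<Longrightarrow> \<rho> i = r i"
    and p0: "p0 \<in> P"
    and theta_nonneg: "\<lbrakk>a \<in> P; x \<in> K\<rbrakk> \<Longrightarrow> 0 \<le> \<theta> a x"
    and theta_sum: "x \<in> K \<Longrightarrow> (\<Sum>a\<in>P. \<theta> a x) \<le> 1"
    and theta_P: "\<lbrakk>a \<in> P; b \<in> P\<rbrakk> \<Longrightarrow> \<theta> a b = (if a = b then 1 else 0)"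
    and theta_osc: "\<lbrakk>i \<in> I; x \<in> g i ` K; y \<in> g i ` K\<rbrakk> \<Longrightarrow> (\<Sum>a\<in>P. \<bar>\<theta> a x - \<theta> a y\<bar>) \<le> \<rho> i"
begin

section \<open>Multiplicative weights against contraction ratios\<close>

definition weight :: "'i list \<Rightarrow> real" where "weight w = prod_list (map \<rho> w)"

lemma weight_simps [simp]: "weight [] = 1" "weight (i # w) = \<rho> i * weight w" "weight (u @ v) =
    weight u * weight v"
  by (auto simp: weight_def)

lemma weight_pos: "w \<in> lists I \<Longrightarrow> 0 < weight w"
  by (induction w) (auto simp: rho_pos)

lemma weight_le_1: "w \<in> lists I \<Longrightarrow> weight w \<le> 1"
proof (induction w)
  case (Cons i w)
  then show ?case using rho_less_1[of i] rho_pos[of i] weight_pos[of w]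
    by (auto intro!: mult_le_one)
qed auto

lemma weight_append_le: "u \<in> lists I \<Longrightarrow> v \<in> lists I \<Longrightarrow> weight (u @ v) \<le> weight u"
  using weight_le_1[of v] weight_pos[of u] by (simp add: mult_left_le)

text \<open>Removing letters from the front pulls \<open>a\<close> back to points of
  \<open>P\<close>, so \<open>rho_P\<close> applies to every letter of \<open>w\<close>.\<close>

lemma weight_eq_ratio:
  "w \<in> lists I \<Longrightarrow> a \<in> P \<Longrightarrow> a \<in> cell w \<Longrightarrow> weight w = ratio w"
proof (induction w arbitrary: a)
  case (Cons i w)
  then obtain b where b: "b \<in> cell w" "a = g i b" by (auto simp: cell_def)
  then have "b \<in> K" using Cons cell_subset_K[of w] by auto
  then have "b \<in> P" using P_back[of i b] Cons b by auto
  moreover have "\<rho> i = r i" using rho_P[of i] Cons b \<open>b \<in> K\<close> by auto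
  ultimately show ?case using Cons b by auto
qed auto

lemma powr_word_bound:
  fixes h k :: "'i \<Rightarrow> real"
  assumes "\<And>i. i \<in> I \<Longrightarrow> h i powr e \<le> k i" "\<And>i. i \<in> I \<Longrightarrow> 0 < h i" "w \<in> lists I"
  shows "prod_list (map h w) powr e \<le> prod_list (map k w) \<and> 0 < prod_list (map h w)"
  using assms(3)
proof (induction w)
  case (Cons i w)
  have "(h i * prod_list (map h w)) powr e = h i powr e * prod_list (map h w) powr e"
    by (rule powr_mult)
  also have "\<dots> \<le> k i * prod_list (map k w)"
    using Cons assms(1)[of i] order_trans[OF powr_ge_zero assms(1)[of i]] by (intro mult_mono) auto
  finally show ?case using Cons assms(2)[of i] by auto
qed auto

lemma exists_exponent:
  assumes h: "\<And>i. i \<in> I \<Longrightarrow> 0 < h i" "\<And>i. i \<in> I \<Longrightarrow> h i < 1"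
    and k: "\<And>i. i \<in> I \<Longrightarrow> 0 < k i" "\<And>i. i \<in> I \<Longrightarrow> k i < 1"
  shows "\<exists>e\<ge>1. \<forall>i\<in>I. h i powr e \<le> (k i :: real)"
proof -
  \<comment> \<open>Every summand is nonnegative, so the sum dominates each of the
    quotients.\<close>
  define e where "e = 1 + (\<Sum>i\<in>I. ln (k i) / ln (h i))"
  have pos: "0 \<le> ln (k i) / ln (h i)" if "i \<in> I" for i
    using h[OF that] k[OF that] by (intro divide_nonpos_nonpos) auto
  show ?thesis
  proof (intro exI[of _ e] conjI ballI)
    show "1 \<le> e" using pos by (simp add: e_def sum_nonneg)
    fix i assume i: "i \<in> I"
    have "ln (k i) / ln (h i) \<le> e"
      using member_le_sum[of i I "\<lambda>i. ln (k i) / ln (h i)"] i pos finI by (auto simp: e_def)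
    moreover have "ln (h i) < 0" using h[OF i] by simp
    ultimately have "e * ln (h i) \<le> ln (k i)" by (simp add: divide_le_eq)
    then have "exp (e * ln (h i)) \<le> k i"
      using k[OF i] by (metis exp_le_cancel_iff exp_ln)
    then show "h i powr e \<le> k i" using h[OF i] by (simp add: powr_def)
  qed
qed

text \<open>Together with the opposite bound below, this supplies the two exponents of the
  distortion function.\<close>

lemma weight_ge_ratio_powr: "\<exists>e\<ge>1. \<forall>w\<in>lists I. ratio w powr e \<le> weight w"
proof -
  obtain e where "e \<ge> 1" "\<forall>i\<in>I. r i powr e \<le> \<rho> i"
    using exists_exponent[of r \<rho>] r_pos r_less_1 rho_pos rho_less_1 by auto
  then show ?thesis using powr_word_bound[of r e \<rho>] r_pos by (auto simp: ratio_def weight_def)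
qed

lemma weight_le_ratio_powr: "\<exists>e>0. \<forall>w\<in>lists I. weight w \<le> ratio w powr e"
proof -
  obtain e where e: "e \<ge> 1" "\<forall>i\<in>I. \<rho> i powr e \<le> r i"
    using exists_exponent[of \<rho> r] r_pos r_less_1 rho_pos rho_less_1 by auto
  have "weight w \<le> ratio w powr (1 / e)" if w: "w \<in> lists I" for w
  proof -
    have "weight w powr e \<le> ratio w"
      using powr_word_bound[of \<rho> e r w] e rho_pos w by (auto simp: ratio_def weight_def)
    then have "(weight w powr e) powr (1 / e) \<le> ratio w powr (1 / e)"
      using e by (intro powr_mono2) auto
    then show ?thesis using e weight_pos[OF w] by (simp add: powr_powr)
  qed
  then show ?thesis using e by (intro exI[of _ "1 / e"]) auto
qed

subsection \<open>Interpolation\<close>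

text \<open>\<open>R k u\<close> agrees with \<open>u\<close> on \<open>P\<close> and repeats the interpolation \<open>S\<close> inside every cell of level at
  most \<open>k\<close>, so that its oscillation over such a cell is bounded by the weight of the cell. Since \<open>S\<close>
  keeps values on \<open>P\<close>, the pieces on two meeting cells fit together.\<close>

definition S :: "('a \<Rightarrow> real) \<Rightarrow> 'a \<Rightarrow> real" where
  "S u x = u p0 + (\<Sum>a\<in>P. (u a - u p0) * \<theta> a x)"

definition address :: "'a \<Rightarrow> 'i \<times> 'a" where
  "address x = (SOME p. fst p \<in> I \<and> snd p \<in> K \<and> g (fst p) (snd p) = x)"

primrec R :: "nat \<Rightarrow> ('a \<Rightarrow> real) \<Rightarrow> 'a \<Rightarrow> real" where
  "R 0 u = S u"
| "R (Suc k) u = (\<lambda>x. R k (S u \<circ> g (fst (address x))) (snd (address x)))"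

lemma address: "x \<in> K \<Longrightarrow>
    fst (address x) \<in> I \<and> snd (address x) \<in> K \<and> g (fst (address x)) (snd (address x)) = x"
  unfolding address_def by (rule someI_ex) (use K_eq in force)

lemma S_P: "b \<in> P \<Longrightarrow> S u b = u b"
proof -
  assume b: "b \<in> P"
  have "(\<Sum>a\<in>P. (u a - u p0) * \<theta> a b) = (\<Sum>a\<in>P. if a = b then u b - u p0 else 0)"
    using b by (intro sum.cong) (auto simp: theta_P)
  then show ?thesis using b finP by (simp add: S_def)
qed

text \<open>The numbers \<open>\<theta> a x\<close> may sum to less than 1. The missing mass is put
  at \<open>p0\<close>, so \<open>S u x\<close> is a convex combination of values of
  \<open>u\<close> on \<open>P\<close>.\<close>

lemma S_range:
  assumes "\<And>a. a \<in> P \<Longrightarrow> m \<le> u a \<and> u a \<le> M" "x \<in> K"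
  shows "m \<le> S u x \<and> S u x \<le> M"
proof -
  define t where "t = (\<Sum>a\<in>P. \<theta> a x)"
  have t: "0 \<le> t" "t \<le> 1" using theta_nonneg theta_sum assms(2)
    by (auto simp: t_def intro!: sum_nonneg)
  have "(\<Sum>a\<in>P. (u a - u p0) * \<theta> a x) \<le> (\<Sum>a\<in>P. (M - u p0) * \<theta> a x)"
    using assms theta_nonneg by (intro sum_mono mult_right_mono) auto
  then have 1: "(\<Sum>a\<in>P. (u a - u p0) * \<theta> a x) \<le> (M - u p0) * t"
    by (simp add: t_def sum_distrib_left)
  have "(\<Sum>a\<in>P. (m - u p0) * \<theta> a x) \<le> (\<Sum>a\<in>P. (u a - u p0) * \<theta> a x)"
    using assms theta_nonneg by (intro sum_mono mult_right_mono) auto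
  then have 2: "(m - u p0) * t \<le> (\<Sum>a\<in>P. (u a - u p0) * \<theta> a x)"
    by (simp add: t_def sum_distrib_left)
  have "(M - u p0) * t \<le> M - u p0" "m - u p0 \<le> (m - u p0) * t"
    using assms(1)[OF p0] mult_left_le[OF t(2), of "M - u p0"] mult_left_mono_neg[OF t(2), of "m - u p0"]
    by simp_all
  then show ?thesis using 1 2 by (auto simp: S_def)
qed

lemma S_osc:
  assumes "\<And>a b. a \<in> P \<Longrightarrow> b \<in> P \<Longrightarrow> \<bar>u a - u b\<bar> \<le> L" "i \<in> I" "x \<in> g i ` K" "y \<in> g i ` K"
  shows "\<bar>S u x - S u y\<bar> \<le> \<rho> i * L"
proof -
  have L: "0 \<le> L" using assms(1)[OF p0 p0] by simp
  have "\<bar>S u x - S u y\<bar> = \<bar>\<Sum>a\<in>P. (u a - u p0) * (\<theta> a x - \<theta> a y)\<bar>"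
    by (simp add: S_def sum_subtractf right_diff_distrib)
  also have "\<dots> \<le> (\<Sum>a\<in>P. \<bar>u a - u p0\<bar> * \<bar>\<theta> a x - \<theta> a y\<bar>)"
    by (rule order_trans[OF sum_abs]) (simp add: abs_mult)
  also have "\<dots> \<le> (\<Sum>a\<in>P. L * \<bar>\<theta> a x - \<theta> a y\<bar>)"
    using assms(1) p0 by (intro sum_mono mult_right_mono) auto
  also have "\<dots> = L * (\<Sum>a\<in>P. \<bar>\<theta> a x - \<theta> a y\<bar>)" by (simp add: sum_distrib_left)
  also have "\<dots> \<le> L * \<rho> i" using theta_osc assms L by (intro mult_left_mono) auto
  finally show ?thesis by (simp add: mult.commute)
qed

lemma R_P: "a \<in> P \<Longrightarrow> R k u a = u a"
proof (induction k arbitrary: u a)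
  case 0
  then show ?case by (simp add: S_P)
next
  case (Suc k)
  then have d: "fst (address a) \<in> I" "snd (address a) \<in> K" "g (fst (address a)) (snd (address a)) =
      a"
    using address PK by auto
  then have "snd (address a) \<in> P" using P_back Suc by metis
  then show ?case using Suc d by (simp add: S_P)
qed

text \<open>If \<open>address\<close> picks another cell, both preimages of the point lie in
  \<open>P\<close>, and \<open>R_P\<close> evaluates both sides to \<open>S u (g i x)\<close>. So
  the choice of address does not matter.\<close>

lemma R_g:
  assumes "i \<in> I" "x \<in> K"
  shows "R (Suc k) u (g i x) = R k (S u \<circ> g i) x"
proof -
  have d: "fst (address (g i x)) \<in> I" "snd (address (g i x)) \<in> K" "g (fst (address (g i x))) (snd (address (g i x))) = g i x"
    using address g_in_K assms by auto
  show ?thesis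
  proof (cases "fst (address (g i x)) = i")
    case True
    then show ?thesis using d g_inj[OF assms(1), of "snd (address (g i x))" x] by simp
  next
    case False
    then have "x \<in> P" "snd (address (g i x)) \<in> P"
      using d assms P_meet by metis+
    then show ?thesis using d by (simp add: R_P)
  qed
qed

lemma R_range:
  assumes "\<And>a. a \<in> P \<Longrightarrow> m \<le> u a \<and> u a \<le> M" "x \<in> K"
  shows "m \<le> R k u x \<and> R k u x \<le> M"
  using assms
proof (induction k arbitrary: u x)
  case 0
  from S_range[of m u M, OF 0] show ?case by simp
next
  case (Suc k)
  have "m \<le> S u (g i y) \<and> S u (g i y) \<le> M" if "i \<in> I" "y \<in> K" for i y
    by (rule S_range) (use Suc.prems(1) g_in_K that in auto)
  then have "m \<le> (S u \<circ> g (fst (address x))) a \<and> (S u \<circ> g (fst (address x))) a \<le> M" if "a \<in> P" for a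
    using that address[OF Suc.prems(2)] PK by auto
  then have "m \<le> R k (S u \<circ> g (fst (address x))) (snd (address x)) \<and>
      R k (S u \<circ> g (fst (address x))) (snd (address x)) \<le> M"
    by (rule Suc.IH) (use address[OF Suc.prems(2)] in auto)
  then show ?case by simp
qed

text \<open>Only the oscillation of \<open>u\<close> on \<open>P\<close> enters. A letter
  \<open>i\<close> replaces \<open>u\<close> by \<open>S u \<circ> g i\<close>, whose oscillation on
  \<open>P\<close> is at most \<open>\<rho> i * L\<close>, because \<open>g i\<close> maps
  \<open>P\<close> into a single first level cell.\<close>

lemma R_osc:
  assumes "\<And>a b. a \<in> P \<Longrightarrow> b \<in> P \<Longrightarrow> \<bar>u a - u b\<bar> \<le> L" "w \<in> lists I" "length w \<le> k" "x \<in> K" "y \<in> K"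
  shows "\<bar>R k u (foldr g w x) - R k u (foldr g w y)\<bar> \<le> weight w * L"
  using assms
proof (induction w arbitrary: k u L)
  case Nil
  define m M where "m = Min (u ` P)" and "M = Max (u ` P)"
  have *: "m \<le> u a \<and> u a \<le> M" if "a \<in> P" for a
    using that finP by (auto simp: m_def M_def)
  have "m \<in> u ` P" "M \<in> u ` P" using finP p0 by (auto simp: m_def M_def intro!: Min_in Max_in)
  then have "M - m \<le> L" using Nil(1) by (metis abs_le_D1 imageE)
  then show ?case using R_range[of m u M x k] R_range[of m u M y k] * Nil by auto
next
  case (Cons i w)
  then obtain k' where k: "k = Suc k'" by (cases k) auto
  have iw: "i \<in> I" "w \<in> lists I" using Cons by auto
  have osc: "\<bar>(S u \<circ> g i) a - (S u \<circ> g i) b\<bar> \<le> \<rho> i * L" if "a \<in> P" "b \<in> P" for a b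
    using S_osc[of u L i "g i a" "g i b"] Cons.prems(1) iw that PK by auto
  have "\<bar>R k' (S u \<circ> g i) (foldr g w x) - R k' (S u \<circ> g i) (foldr g w y)\<bar> \<le> weight w * (\<rho> i * L)"
    using Cons k by (intro Cons.IH osc) auto
  then show ?case using R_g[OF iw(1) foldr_in_K[OF iw(2)]] Cons.prems k by (simp add: mult_ac)
qed


subsection \<open>The metric\<close>

text \<open>This is the dual description of the infimum of the total weight over chains of cells. Working with
  each level \<open>k\<close> separately avoids passing to the limit in \<open>R k\<close>.\<close>

definition admissible :: "nat \<Rightarrow> ('a \<Rightarrow> real) set" where
  "admissible k = {\<phi>. \<forall>w\<in>lists I. length w \<le> k \<longrightarrow>
     (\<forall>x\<in>K. \<forall>y\<in>K. \<bar>\<phi> (foldr g w x) - \<phi> (foldr g w y)\<bar> \<le> weight w)}"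

definition D_level :: "nat \<Rightarrow> 'a \<Rightarrow> 'a \<Rightarrow> real" where
  "D_level k x y = (SUP \<phi>\<in>admissible k. \<bar>\<phi> x - \<phi> y\<bar>)"

text \<open>\<open>D_level\<close> decreases with the level, so on \<open>K\<close> the infimum is a
  limit. The value 0 elsewhere keeps \<open>D\<close> nonnegative and symmetric on the whole type,
  as \<open>Metric_space\<close> demands.\<close>

definition D :: "'a \<Rightarrow> 'a \<Rightarrow> real" where
  "D x y = (if x \<in> K \<and> y \<in> K then INF k. D_level k x y else 0)"

lemma admissibleD: "\<phi> \<in> admissible k \<Longrightarrow> w \<in> lists I \<Longrightarrow> length w \<le> k \<Longrightarrow> x \<in> K \<Longrightarrow> y \<in> K \<Longrightarrow>
    \<bar>\<phi> (foldr g w x) - \<phi> (foldr g w y)\<bar> \<le> weight w"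
  by (simp add: admissible_def)

lemma zero_admissible: "(\<lambda>_. 0) \<in> admissible k"
  using weight_pos by (auto simp: admissible_def less_imp_le)

lemma admissible_antimono: "k \<le> l \<Longrightarrow> admissible l \<subseteq> admissible k"
  by (auto simp: admissible_def)

text \<open>The empty word bounds all differences over \<open>K\<close> by 1, so the supremum is one
  of a bounded set.\<close>

lemma D_level_ge: "\<phi> \<in> admissible k \<Longrightarrow> x \<in> K \<Longrightarrow> y \<in> K \<Longrightarrow> \<bar>\<phi> x - \<phi> y\<bar> \<le> D_level k x y"
  unfolding D_level_def by (rule cSUP_upper) (auto intro!: bdd_aboveI[of _ 1] dest: admissibleD[of _ k "[]" x y])

lemma D_level_le: "(\<And>\<phi>. \<phi> \<in> admissible k \<Longrightarrow> \<bar>\<phi> x - \<phi> y\<bar> \<le> B) \<Longrightarrow> D_level k x y \<le> B"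
  unfolding D_level_def using zero_admissible by (intro cSUP_least) auto

lemma D_level_nonneg: "x \<in> K \<Longrightarrow> y \<in> K \<Longrightarrow> 0 \<le> D_level k x y"
  using D_level_ge[OF zero_admissible] by fastforce

lemma D_le_level: "x \<in> K \<Longrightarrow> y \<in> K \<Longrightarrow> D x y \<le> D_level k x y"
  using D_level_nonneg by (auto simp: D_def intro!: cINF_lower bdd_belowI[of _ 0])

lemma D_ge: "x \<in> K \<Longrightarrow> y \<in> K \<Longrightarrow> (\<And>k. B \<le> D_level k x y) \<Longrightarrow> B \<le> D x y"
  by (auto simp: D_def intro!: cINF_greatest)

lemma D_nonneg: "0 \<le> D x y"
  using D_ge[of x y 0] D_level_nonneg by (auto simp: D_def)

lemma D_commute: "D x y = D y x"
  by (auto simp: D_def D_level_def abs_minus_commute)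

lemma D_refl: "D x x = 0"
proof (cases "x \<in> K")
  case True
  then have "D_level 0 x x \<le> 0" by (intro D_level_le) auto
  then show ?thesis using D_le_level[OF True True, of 0] D_nonneg[of x x] by linarith
qed (simp add: D_def)

text \<open>The level \<open>max k l\<close> serves both summands; the infima over \<open>k\<close>
  and \<open>l\<close> are then taken one after the other.\<close>

lemma D_triangle:
  assumes "x \<in> K" "y \<in> K" "z \<in> K"
  shows "D x z \<le> D x y + D y z"
proof -
  have "D x z \<le> D_level k x y + D_level l y z" for k l
  proof -
    have "D x z \<le> D_level (max k l) x z" using assms by (intro D_le_level)
    also have "\<dots> \<le> D_level k x y + D_level l y z"
    proof (rule D_level_le)
      fix \<phi> assume "\<phi> \<in> admissible (max k l)"
      then have "\<phi> \<in> admissible k" "\<phi> \<in> admissible l"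
        using admissible_antimono[of k "max k l"] admissible_antimono[of l "max k l"] by auto
      then show "\<bar>\<phi> x - \<phi> z\<bar> \<le> D_level k x y + D_level l y z"
        using D_level_ge[of \<phi> k x y] D_level_ge[of \<phi> l y z] assms by linarith
    qed
    finally show ?thesis .
  qed
  then have "D x z - D_level l y z \<le> D_level k x y" for k l by (simp add: diff_le_eq)
  then have "D x z - D_level l y z \<le> D x y" for l using assms by (intro D_ge)
  then have "D x z - D x y \<le> D_level l y z" for l by (simp add: algebra_simps)
  then have "D x z - D x y \<le> D y z" using assms by (intro D_ge)
  then show ?thesis by simp
qed

lemma D_cell: "w \<in> lists I \<Longrightarrow> x \<in> cell w \<Longrightarrow> y \<in> cell w \<Longrightarrow> D x y \<le> weight w"
proof -
  assume w: "w \<in> lists I" "x \<in> cell w" "y \<in> cell w"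
  then have "D_level (length w) x y \<le> weight w"
    by (intro D_level_le) (auto simp: cell_def intro: admissibleD)
  moreover have "D x y \<le> D_level (length w) x y" using w cell_subset_K by (intro D_le_level) auto
  ultimately show ?thesis by simp
qed

text \<open>A test function pulled back along \<open>w\<close> and divided by
  \<open>weight w\<close> is again a test function, with \<open>length w\<close> levels
  fewer.\<close>

lemma D_scale:
  assumes w: "w \<in> lists I" and xy: "x \<in> K" "y \<in> K"
  shows "D (foldr g w x) (foldr g w y) \<le> weight w * D x y"
proof -
  have "D (foldr g w x) (foldr g w y) / weight w \<le> D_level k x y" for k
  proof -
    have "D (foldr g w x) (foldr g w y) \<le> D_level (length w + k) (foldr g w x) (foldr g w y)"
      using assms foldr_in_K by (intro D_le_level)
    also have "\<dots> \<le> weight w * D_level k x y"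
    proof (rule D_level_le)
      fix \<phi> assume phi: "\<phi> \<in> admissible (length w + k)"
      have "(\<lambda>x. \<phi> (foldr g w x) / weight w) \<in> admissible k"
        unfolding admissible_def
      proof (intro CollectI ballI impI)
        fix v x y assume v: "v \<in> lists I" "length v \<le> k" "x \<in> K" "y \<in> K"
        have "\<bar>\<phi> (foldr g (w @ v) x) - \<phi> (foldr g (w @ v) y)\<bar> \<le> weight (w @ v)"
          using v w by (intro admissibleD[OF phi]) auto
        then show "\<bar>\<phi> (foldr g w (foldr g v x)) / weight w - \<phi> (foldr g w (foldr g v y)) / weight w\<bar> \<le> weight v"
          using weight_pos[OF w] by (simp add: diff_divide_distrib[symmetric] divide_le_eq mult.commute)
      qed
      from D_level_ge[OF this xy] show "\<bar>\<phi> (foldr g w x) - \<phi> (foldr g w y)\<bar> \<le>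
          weight w * D_level k x y"
        using weight_pos[OF w] by (simp add: diff_divide_distrib[symmetric] divide_le_eq mult.commute)
    qed
    finally show ?thesis using weight_pos[OF w] by (simp add: divide_le_eq mult.commute)
  qed
  then have "D (foldr g w x) (foldr g w y) / weight w \<le> D x y" using xy by (intro D_ge)
  then show ?thesis using weight_pos[OF w] by (simp add: divide_le_eq mult.commute)
qed

subsection \<open>Comparison of weights\<close>

lemma weight_lower: "\<exists>C>0. \<forall>w\<in>lists I. l \<le> ratio w \<longrightarrow> C \<le> weight w" if "0 < l"
proof -
  obtain e where "e \<ge> 1" "\<forall>w\<in>lists I. ratio w powr e \<le> weight w" using weight_ge_ratio_powr by blast
  then show ?thesis using that
    by (intro exI[of _ "l powr e"]) (auto intro: order_trans[OF powr_mono2])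
qed

text \<open>A cell this close to \<open>a\<close> is only boundedly smaller than that of a prefix
  \<open>u\<close> containing \<open>a\<close>, and the weight of \<open>u\<close> is exactly its
  ratio.\<close>

lemma weight_ratio_near_P:
  assumes L: "0 < L"
  shows "\<exists>C>0. \<forall>a\<in>P. \<forall>w\<in>lists I. \<forall>x\<in>cell w. dist x a \<le> L * ratio w \<longrightarrow>
     weight w \<le> C * ratio w \<and> ratio w \<le> C * weight w"
proof -
  obtain c0 where c0: "c0 > 0" and c0': "\<forall>a\<in>P. \<forall>w\<in>lists I. \<forall>x\<in>cell w. a \<notin> cell w \<longrightarrow>
     (\<exists>u v. w = u @ v \<and> v \<noteq> [] \<and> a \<in> cell u \<and> c0 * ratio u \<le> dist a x)"
    using dist_P_cell by blast
  obtain C1 where C1: "C1 > 0" "\<forall>w\<in>lists I. c0 / L \<le> ratio w \<longrightarrow> C1 \<le> weight w"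
    using weight_lower[of "c0 / L"] c0 L by auto
  define C where "C = 1 + L / c0 + 1 / C1"
  have C: "C > 0" "1 \<le> C" "L / c0 \<le> C" "1 / C1 \<le> C"
    using c0 L C1 by (auto simp: C_def intro!: add_pos_pos)
  show ?thesis
  proof (intro exI[of _ C] conjI[OF C(1)] ballI impI)
    fix a w x assume a: "a \<in> P" and w: "w \<in> lists I" and x: "x \<in> cell w" and d: "dist x a \<le>
        L * ratio w"
    show "weight w \<le> C * ratio w \<and> ratio w \<le> C * weight w"
    proof (cases "a \<in> cell w")
      case True
      then show ?thesis using weight_eq_ratio[OF w a] ratio_pos[OF w] C
        by (simp add: mult_le_cancel_right1)
    next
      case False
      then obtain u v where uv: "w = u @ v" "a \<in> cell u" "c0 * ratio u \<le> dist a x"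
        using c0' a w x by blast
      then have mem: "u \<in> lists I" "v \<in> lists I" using w by auto
      have u: "weight u = ratio u" using weight_eq_ratio mem a uv by blast
      have pos: "ratio u > 0" "ratio v > 0" "weight v > 0" using ratio_pos weight_pos mem by auto
      have "c0 * ratio u \<le> (L * ratio v) * ratio u" using uv d by (simp add: dist_commute mult_ac)
      then have v: "c0 / L \<le> ratio v" using pos L by (simp add: divide_le_eq mult.commute)
      have "weight v \<le> 1" using weight_le_1 mem by blast
      also have "1 \<le> L / c0 * ratio v" using v L c0 by (simp add: field_simps)
      also have "\<dots> \<le> C * ratio v" using C pos by (intro mult_right_mono) auto
      finally have 1: "weight v \<le> C * ratio v" .
      have "ratio v \<le> 1" using ratio_le_1 mem by blast
      also have "1 \<le> 1 / C1 * weight v" using C1 v mem by (simp add: field_simps)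
      also have "\<dots> \<le> C * weight v" using C pos by (intro mult_right_mono) auto
      finally have 2: "ratio v \<le> C * weight v" .
      show ?thesis using mult_left_mono[OF 1, of "ratio u"] mult_left_mono[OF 2, of "ratio u"] pos u uv
        by (simp add: mult_ac)
    qed
  qed
qed


lemma meet_vertex:
  assumes "u \<in> lists I" "i \<in> I" "j \<in> I" "i \<noteq> j" "z \<in> cell (u @ [i])" "z \<in> cell (u @ [j])"
  obtains a where "a \<in> P" "z = foldr g (u @ [i]) a"
proof -
  obtain a b where *: "a \<in> K" "z = foldr g (u @ [i]) a" "b \<in> K" "z = foldr g (u @ [j]) b"
    using assms by (auto simp: cell_def)
  then have "a \<in> P" using P_meet_word[of u i "[]" j "[]" a b] assms by auto
  then show ?thesis using that * by blast
qed

text \<open>Rescaling by \<open>u @ [i]\<close> turns the vertex into a point of \<open>P\<close>.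
  The letter \<open>i\<close> need not satisfy \<open>\<rho> i = r i\<close>, but both numbers lie
  between a positive constant and 1. The prefix \<open>u\<close> is left out of the conclusion, as
  its weight may be far from its ratio; it cancels in the applications.\<close>

lemma weight_ratio_near_vertex:
  assumes L: "0 < L"
  shows "\<exists>C>0. \<forall>u\<in>lists I. \<forall>i\<in>I. \<forall>w\<in>lists I. \<forall>a\<in>P. \<forall>x\<in>cell (u @ i # w).
     dist x (foldr g (u @ [i]) a) \<le> L * ratio (u @ i # w) \<longrightarrow>
     weight (i # w) \<le> C * ratio (i # w) \<and> ratio (i # w) \<le> C * weight (i # w)"
proof -
  obtain C1 where C1: "C1 > 0" and C1': "\<forall>a\<in>P. \<forall>w\<in>lists I. \<forall>x\<in>cell w. dist x a \<le> L * ratio w \<longrightarrow>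
     weight w \<le> C1 * ratio w \<and> ratio w \<le> C1 * weight w"
    using weight_ratio_near_P[OF L] by blast
  obtain C2 where C2: "C2 > 0" and C2': "\<forall>w\<in>lists I. rmin \<le> ratio w \<longrightarrow> C2 \<le> weight w"
    using weight_lower[OF rmin(1)] by blast
  define C where "C = C1 * (1 / rmin + 1 / C2)"
  show ?thesis
  proof (intro exI[of _ C] conjI ballI impI)
    show "0 < C" using C1 C2 rmin(1) by (simp add: C_def add_pos_pos)
    fix u i w a x assume h: "u \<in> lists I" "i \<in> I" "w \<in> lists I" "a \<in> P" "x \<in> cell (u @ i # w)"
      "dist x (foldr g (u @ [i]) a) \<le> L * ratio (u @ i # w)"
    have ui: "u @ [i] \<in> lists I" using h by auto
    obtain x' where x': "x' \<in> cell w" "x = foldr g (u @ [i]) x'"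
      using h(5) cell_append[of "u @ [i]" w] by auto
    have "ratio (u @ [i]) * dist x' a \<le> ratio (u @ [i]) * (L * ratio w)"
      using h(6) dist_foldr[OF ui] x' by (simp add: mult_ac)
    then have "dist x' a \<le> L * ratio w"
      using ratio_pos[OF ui] by (simp add: mult_le_cancel_left)
    then have w: "weight w \<le> C1 * ratio w" "ratio w \<le> C1 * weight w" using C1' h x' by auto
    have i: "rmin \<le> r i" "C2 \<le> \<rho> i" "\<rho> i \<le> 1" "r i \<le> 1"
      using rmin(3) C2'[rule_format, of "[i]"] h rho_less_1[of i] r_less_1[of i] by auto
    have "\<rho> i * rmin \<le> rmin" "r i * C2 \<le> C2"
      using i rmin(1) C2 rho_pos[OF h(2)] r_pos[OF h(2)] by (intro mult_left_le_one_le; simp)+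
    then have "\<rho> i * rmin \<le> r i" "r i * C2 \<le> \<rho> i" using i by linarith+
    then have "\<rho> i \<le> (1 / rmin) * r i" "r i \<le> (1 / C2) * \<rho> i"
      using rmin(1) C2 by (auto simp: pos_le_divide_eq)
    moreover have "(1 / rmin) * r i \<le> (1 / rmin + 1 / C2) * r i" "(1 / C2) * \<rho> i \<le>
        (1 / rmin + 1 / C2) * \<rho> i"
      using r_pos[OF h(2)] rho_pos[OF h(2)] rmin(1) C2 by (auto simp: distrib_right)
    ultimately have i': "\<rho> i \<le> (1 / rmin + 1 / C2) * r i" "r i \<le> (1 / rmin + 1 / C2) * \<rho> i"
      by linarith+
    have pos: "0 < \<rho> i" "0 < r i" "0 < weight w" "0 < ratio w" "0 < 1 / rmin + 1 / C2"
      using r_pos rho_pos weight_pos ratio_pos h rmin(1) C2 by (auto intro: add_pos_pos)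
    have "\<rho> i * weight w \<le> ((1 / rmin + 1 / C2) * r i) * (C1 * ratio w)"
      using pos i' w by (intro mult_mono) auto
    moreover have "r i * ratio w \<le> ((1 / rmin + 1 / C2) * \<rho> i) * (C1 * weight w)"
      using pos i' w by (intro mult_mono) auto
    ultimately show "weight (i # w) \<le> C * ratio (i # w)" "ratio (i # w) \<le> C * weight (i # w)"
      by (simp_all add: C_def mult_ac)
  qed
qed

text \<open>The common vertex is written through both cells, so that either side can be rescaled to
  a point of \<open>P\<close>.\<close>

definition pinched :: "'i list \<Rightarrow> 'i \<Rightarrow> 'i \<Rightarrow> 'a \<Rightarrow> 'a \<Rightarrow> bool" where
  "pinched u i j x y \<longleftrightarrow> (\<exists>a\<in>P. \<exists>b\<in>P. foldr g (u @ [i]) a = foldr g (u @ [j]) b \<and>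
     c * dist x (foldr g (u @ [i]) a) \<le> dist x y \<and> c * dist y (foldr g (u @ [j]) b) \<le> dist x y)"

text \<open>After scaling by \<open>u\<close>, disjoint first level cells are a fixed distance
  apart. For meeting ones, angle separation, used in both orders, keeps both points near the
  vertex.\<close>

lemma dist_meeting_or_apart:
  "\<exists>\<delta>>0. \<forall>u\<in>lists I. \<forall>i\<in>I. \<forall>j\<in>I. \<forall>x\<in>cell (u @ [i]). \<forall>y\<in>cell (u @ [j]). i \<noteq> j \<longrightarrow>
     \<delta> * ratio u \<le> dist x y \<or> pinched u i j x y"
proof -
  obtain \<delta> where d: "\<delta> > 0" "\<forall>i\<in>I. \<forall>j\<in>I. cell [i] \<inter> cell [j] = {} \<longrightarrow>
      (\<forall>x\<in>cell [i]. \<forall>y\<in>cell [j]. \<delta> \<le> dist x y)"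
    using dist_disjoint_cells by blast
  show ?thesis
  proof (intro exI[of _ \<delta>] conjI d(1) ballI impI)
    fix u i j x y assume h: "u \<in> lists I" "i \<in> I" "j \<in> I" "x \<in> cell (u @ [i])" "y \<in> cell (u @ [j])" "i \<noteq> j"
    show "\<delta> * ratio u \<le> dist x y \<or> pinched u i j x y"
    proof (cases "cell [i] \<inter> cell [j] = {}")
      case True
      obtain x' y' where "x' \<in> cell [i]" "x = foldr g u x'" "y' \<in> cell [j]" "y = foldr g u y'"
        using h by (auto simp: cell_append)
      then have "\<delta> * ratio u \<le> dist x y"
        using d(2) True h dist_foldr[OF h(1)] ratio_pos[OF h(1)] by (simp add: mult.commute)
      then show ?thesis ..
    next
      case False
      then obtain z where z: "z \<in> cell (u @ [i])" "z \<in> cell (u @ [j])"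
        unfolding cell_append by blast
      obtain a where a: "a \<in> P" "z = foldr g (u @ [i]) a" using meet_vertex[OF h(1,2,3,6) z] .
      obtain b where b: "b \<in> P" "z = foldr g (u @ [j]) b"
        using meet_vertex[OF h(1,3,2) h(6)[symmetric] z(2,1)] .
      have "c * dist x z \<le> dist x y" using separation_cells[OF h(1,2,3,6) z h(4,5)] .
      moreover have "c * dist y z \<le> dist x y"
        using separation_cells[OF h(1,3,2) h(6)[symmetric] z(2,1) h(5,4)]
          by (simp add: dist_commute)
      ultimately show ?thesis using a b unfolding pinched_def by metis
    qed
  qed
qed

text \<open>Below their last common ancestor two nearby cells of similar size either have bounded depth or
  both lie near the meeting point of two cells, where weight and ratio are comparable.\<close>

lemma weight_compare:
  assumes L: "0 < L" and l: "0 < l"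
  shows "\<exists>C>0. \<forall>u\<in>lists I. \<forall>v\<in>lists I. \<forall>x\<in>cell u. \<forall>y\<in>cell v.
     dist x y \<le> L * ratio u \<longrightarrow> l * ratio u \<le> ratio v \<longrightarrow> weight u \<le> C * weight v"
proof -
  obtain \<delta> where d: "\<delta> > 0" and d': "\<forall>u\<in>lists I. \<forall>i\<in>I. \<forall>j\<in>I. \<forall>x\<in>cell (u @ [i]). \<forall>y\<in>cell (u @ [j]). i \<noteq> j \<longrightarrow>
     \<delta> * ratio u \<le> dist x y \<or> pinched u i j x y"
    by (rule exE[OF dist_meeting_or_apart], erule conjE, rule that)
  obtain C1 where C1: "C1 > 0" and C1': "\<forall>w\<in>lists I. l \<le> ratio w \<longrightarrow> C1 \<le> weight w"
    using weight_lower[OF l] by blast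
  obtain C2 where C2: "C2 > 0" and C2': "\<forall>w\<in>lists I. l * \<delta> / L \<le> ratio w \<longrightarrow> C2 \<le> weight w"
    using weight_lower[of "l * \<delta> / L"] l d L by auto
  \<comment> \<open>Near a vertex, \<open>x\<close> is within \<open>L / c\<close> times
    \<open>ratio u\<close> of it, and \<open>y\<close> within \<open>L / (c * l)\<close> times
    \<open>ratio v\<close>, since \<open>ratio u\<close> is at most \<open>ratio v / l\<close>. The
    sum covers both.\<close>
  have Lcl: "0 < L / c + L / (c * l)" using L l c_pos by (auto intro: add_pos_pos)
  obtain C3 where C3: "C3 > 0" and C3': "\<forall>u\<in>lists I. \<forall>i\<in>I. \<forall>w\<in>lists I. \<forall>a\<in>P. \<forall>x\<in>cell (u @ i # w).
     dist x (foldr g (u @ [i]) a) \<le> (L / c + L / (c * l)) * ratio (u @ i # w) \<longrightarrow>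
     weight (i # w) \<le> C3 * ratio (i # w) \<and> ratio (i # w) \<le> C3 * weight (i # w)"
    by (rule exE[OF weight_ratio_near_vertex[OF Lcl]], erule conjE, rule that)
  define C where "C = 1 + 1 / C1 + 1 / C2 + C3 * C3 / l"
  have C: "0 < C" "1 \<le> C" "1 / C1 \<le> C" "1 / C2 \<le> C" "C3 * C3 / l \<le> C"
    using C1 C2 C3 l by (auto simp: C_def add_pos_pos)
  show ?thesis
  proof (intro exI[of _ C] conjI C(1) ballI impI)
    fix u v x y assume u: "u \<in> lists I" and v: "v \<in> lists I" and x: "x \<in> cell u" and y: "y \<in> cell v"
      and dist: "dist x y \<le> L * ratio u" and rr: "l * ratio u \<le> ratio v"
    have pos: "0 < ratio u" "0 < weight u" "0 < ratio v" "0 < weight v"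
      using u v ratio_pos weight_pos by auto
    consider (1) w where "u = v @ w" | (2) w where "v = u @ w" | (3) "parallel u v"
      by (metis parallel_def prefix_def)
    then show "weight u \<le> C * weight v"
    proof cases
      case 1
      then have "weight u \<le> 1 * weight v" using weight_append_le[of v w] u by auto
      also have "\<dots> \<le> C * weight v" using C pos by (intro mult_right_mono) auto
      finally show ?thesis .
    next
      case 2
      then have w: "w \<in> lists I" using v by auto
      have "l \<le> ratio w" using rr 2 pos by simp
      then have "1 \<le> 1 / C1 * weight w" using C1' w C1 by simp
      also have "\<dots> \<le> C * weight w" using C weight_pos[OF w] by (intro mult_right_mono) auto
      finally have "weight u * 1 \<le> weight u * (C * weight w)" using pos
        by (intro mult_left_mono) auto
      then show ?thesis using 2 by (simp add: mult_ac)
    next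
      case 3
      then obtain t i u' j v' where ij: "i \<noteq> j" "u = t @ i # u'" "v = t @ j # v'"
        using parallel_decomp by blast
      have mem: "t \<in> lists I" "i \<in> I" "u' \<in> lists I" "j \<in> I" "v' \<in> lists I" using u v ij by auto
      have pos': "0 < ratio t" "0 < weight t" using mem ratio_pos weight_pos by auto
      have xi: "x \<in> cell (t @ [i])" using x ij cell_append_subset[of u' "t @ [i]"] mem by auto
      have yj: "y \<in> cell (t @ [j])" using y ij cell_append_subset[of v' "t @ [j]"] mem by auto
      have m: "i # u' \<in> lists I" "j # v' \<in> lists I" using mem by auto
      have "\<delta> * ratio t \<le> dist x y \<or> pinched t i j x y"
        using d'[rule_format, OF mem(1,2,4) xi yj ij(1)] .
      then have "weight (i # u') \<le> C * weight (j # v')"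
      proof
        assume "\<delta> * ratio t \<le> dist x y"
        also note dist
        also have "L * ratio u \<le> L / l * ratio v" using rr L l by (simp add: field_simps)
        finally have "\<delta> * ratio t \<le> (L / l * ratio (j # v')) * ratio t" using ij
          by (simp add: mult_ac)
        then have "\<delta> \<le> L / l * ratio (j # v')" using pos' by (simp only: mult_le_cancel_right_pos)
        then have "l * \<delta> / L \<le> ratio (j # v')" using l L by (simp add: field_simps)
        then have "C2 \<le> weight (j # v')" using C2' m by blast
        then have "1 \<le> 1 / C2 * weight (j # v')" using C2 by (simp add: field_simps)
        also have "\<dots> \<le> C * weight (j # v')" using C weight_pos[OF m(2)]
          by (intro mult_right_mono) auto
        finally show ?thesis using weight_le_1[OF m(1)] by linarith
      next
        assume "pinched t i j x y"
        then obtain a b where ab: "a \<in> P" "b \<in> P"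
          "c * dist x (foldr g (t @ [i]) a) \<le> dist x y" "c * dist y (foldr g (t @ [j]) b) \<le>
              dist x y"
          unfolding pinched_def by blast
        have Lu: "L * ratio u \<le> L / l * ratio v" using rr L l by (simp add: field_simps)
        have "dist x (foldr g (t @ [i]) a) \<le> (L / c) * ratio u"
          using ab(3) dist c_pos by (simp add: field_simps)
        also have "\<dots> \<le> (L / c + L / (c * l)) * ratio u"
          using L l c_pos pos by (intro mult_right_mono) auto
        finally have 1: "weight (i # u') \<le> C3 * ratio (i # u')" using C3' mem ab x ij by blast
        have "c * dist y (foldr g (t @ [j]) b) \<le> L / l * ratio v" using ab(4) dist Lu by linarith
        then have "dist y (foldr g (t @ [j]) b) \<le> L / (c * l) * ratio v"
          using c_pos l by (simp add: field_simps)
        also have "\<dots> \<le> (L / c + L / (c * l)) * ratio v"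
          using L l c_pos pos by (intro mult_right_mono) auto
        finally have 2: "ratio (j # v') \<le> C3 * weight (j # v')" using C3' mem ab y ij by blast
        have "(l * ratio (i # u')) * ratio t \<le> ratio (j # v') * ratio t" using rr ij
          by (simp add: mult_ac)
        then have "l * ratio (i # u') \<le> ratio (j # v')" using pos'
          by (simp only: mult_le_cancel_right_pos)
        then have "ratio (i # u') \<le> (1 / l) * ratio (j # v')" using l by (simp add: field_simps)
        also have "\<dots> \<le> (1 / l) * (C3 * weight (j # v'))" using 2 l by (intro mult_left_mono) auto
        finally have "C3 * ratio (i # u') \<le> C3 * ((1 / l) * (C3 * weight (j # v')))"
          using C3 by (intro mult_left_mono) auto
        also have "\<dots> = C3 * C3 / l * weight (j # v')" by simp
        also have "\<dots> \<le> C * weight (j # v')" using C weight_pos[OF m(2)]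
          by (intro mult_right_mono) auto
        finally show ?thesis using 1 by linarith
      qed
      then have "weight t * weight (i # u') \<le> weight t * (C * weight (j # v'))" using pos'
        by (intro mult_left_mono) auto
      then show ?thesis using ij by (simp add: mult_ac)
    qed
  qed
qed

subsection \<open>Upper and lower bounds\<close>

text \<open>Applied to a cell at \<open>x\<close> that misses \<open>a\<close>,
  \<open>dist_P_cell\<close> gives a cell containing both points. Its weight is its ratio, which is
  controlled by the distance.\<close>

lemma D_le_dist_P: "\<exists>C>0. \<forall>a\<in>P. \<forall>x\<in>K. D x a \<le> C * dist x a"
proof -
  obtain c0 where c0: "c0 > 0" and c0': "\<forall>a\<in>P. \<forall>w\<in>lists I. \<forall>x\<in>cell w. a \<notin> cell w \<longrightarrow>
     (\<exists>u v. w = u @ v \<and> v \<noteq> [] \<and> a \<in> cell u \<and> c0 * ratio u \<le> dist a x)"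
    using dist_P_cell by blast
  have "D x a \<le> (1 / c0) * dist x a" if a: "a \<in> P" and x: "x \<in> K" for a x
  proof (cases "x = a")
    case False
    \<comment> \<open>So small that no cell of ratio at most \<open>s\<close> contains both points;
      the minimum with 1 allows \<open>cell_extend\<close> to start from the empty word.\<close>
    define s where "s = min 1 (dist x a / (2 * diam_bound))"
    have s: "0 < s" "s \<le> 1" "diam_bound * s < dist x a"
    proof -
      have "diam_bound * s \<le> diam_bound * (dist x a / (2 * diam_bound))" using diam_bound_pos
        by (intro mult_left_mono) (auto simp: s_def)
      also have "\<dots> = dist x a / 2" using diam_bound_pos by simp
      finally show "diam_bound * s < dist x a" using False zero_less_dist_iff[of x a] by linarith
    qed (use False diam_bound_pos in \<open>auto simp: s_def\<close>)
    obtain w where w: "w \<in> lists I" "x \<in> cell w" "ratio w \<le> s"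
      using cell_extend[of x "[]" s] x s by auto
    have "a \<notin> cell w"
    proof
      assume "a \<in> cell w"
      then have "dist x a \<le> diam_bound * ratio w" using dist_cell w by blast
      also have "\<dots> \<le> diam_bound * s" using w diam_bound_pos by (intro mult_left_mono) auto
      finally show False using s by simp
    qed
    then obtain u v where uv: "w = u @ v" "a \<in> cell u" "c0 * ratio u \<le> dist a x"
      using c0' a w by blast
    then have mem: "u \<in> lists I" "v \<in> lists I" using w by auto
    have "D x a \<le> weight u"
      using D_cell[of u x a] mem uv w cell_append_subset[of v u] by auto
    also have "\<dots> = ratio u" using weight_eq_ratio mem a uv by blast
    also have "\<dots> \<le> (1 / c0) * dist x a" using uv c0 by (simp add: field_simps dist_commute)
    finally show ?thesis .
  qed (simp add: D_refl)
  then show ?thesis using c0 by (intro exI[of _ "1 / c0"]) auto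
qed

text \<open>Let \<open>t\<close> be the longest prefix of \<open>w\<close> whose cell contains
  \<open>y\<close>. If the two points are apart at the scale of \<open>t\<close>, then
  \<open>w\<close> is only boundedly smaller and \<open>D_cell\<close> for \<open>t\<close>
  suffices. Otherwise go through the vertex: near it \<open>D\<close> is controlled by
  \<open>dist\<close>, and ratios convert back into weights.\<close>

lemma D_upper:
  assumes L: "0 < L"
  shows "\<exists>C>0. \<forall>w\<in>lists I. \<forall>x\<in>cell w. \<forall>y\<in>K. dist x y \<le> L * ratio w \<longrightarrow> D x y \<le> C * weight w"
proof -
  obtain \<delta> where d: "\<delta> > 0" and d': "\<forall>u\<in>lists I. \<forall>i\<in>I. \<forall>j\<in>I. \<forall>x\<in>cell (u @ [i]). \<forall>y\<in>cell (u @ [j]). i \<noteq> j \<longrightarrow>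
     \<delta> * ratio u \<le> dist x y \<or> pinched u i j x y"
    by (rule exE[OF dist_meeting_or_apart], erule conjE, rule that)
  obtain C1 where C1: "C1 > 0" and C1': "\<forall>w\<in>lists I. \<delta> / L \<le> ratio w \<longrightarrow> C1 \<le> weight w"
    using weight_lower[of "\<delta> / L"] L d by auto
  obtain C2 where C2: "C2 > 0" and C2': "\<forall>a\<in>P. \<forall>x\<in>K. D x a \<le> C2 * dist x a"
    using D_le_dist_P by blast
  obtain C3 where C3: "C3 > 0" and C3': "\<forall>u\<in>lists I. \<forall>i\<in>I. \<forall>w\<in>lists I. \<forall>a\<in>P. \<forall>x\<in>cell (u @ i # w).
     dist x (foldr g (u @ [i]) a) \<le> (L / c) * ratio (u @ i # w) \<longrightarrow>
     weight (i # w) \<le> C3 * ratio (i # w) \<and> ratio (i # w) \<le> C3 * weight (i # w)"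
    by (rule exE[OF weight_ratio_near_vertex[OF divide_pos_pos[OF L c_pos]]], erule conjE, rule that)
  \<comment> \<open>\<open>C2\<close> is the constant at points of \<open>P\<close>,
    \<open>c\<close> comes from angle separation, and \<open>rmin\<close> accounts for the letter
    after \<open>t\<close> that leads to the vertex.\<close>
  define C4 where "C4 = C2 / (c * rmin)"
  have C4: "C4 > 0" using C2 c_pos rmin(1) by (simp add: C4_def)
  define C where "C = 1 + 1 / C1 + 2 * C4 * L * C3"
  have C: "0 < C" "1 \<le> C" "1 / C1 \<le> C" "2 * C4 * L * C3 \<le> C"
    using C1 C4 C3 L by (auto simp: C_def add_pos_pos)
  have vertex: "D x (foldr g (t @ [i]) a) \<le> weight t / ratio t * C4 * e"
    if h: "t \<in> lists I" "i \<in> I" "a \<in> P" "x \<in> cell (t @ [i])" "c * dist x (foldr g (t @ [i]) a) \<le> e"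
    for t i a x e
  proof -
    have ti: "t @ [i] \<in> lists I" using h by auto
    obtain x' where x': "x' \<in> K" "x = foldr g (t @ [i]) x'" using h(4) by (auto simp: cell_def)
    have pos: "0 < ratio t" "0 < weight t" "0 < r i" "0 < \<rho> i"
      using h ratio_pos weight_pos r_pos rho_pos by auto
    have e: "0 \<le> e" using h(5) c_pos zero_le_dist order_trans mult_nonneg_nonneg less_imp_le
      by metis
    have "dist x (foldr g (t @ [i]) a) \<le> e / c" using h(5) c_pos by (simp add: field_simps)
    then have "dist x' a * (ratio t * r i) \<le> e / c"
      using dist_foldr[OF ti] x' by (simp add: mult_ac)
    then have "dist x' a \<le> e / c / (ratio t * r i)" using pos by (subst pos_le_divide_eq) auto
    also have "\<dots> \<le> e / c / (ratio t * rmin)"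
      using e c_pos pos rmin(1) rmin(3)[OF h(2)] by (intro divide_left_mono mult_left_mono) auto
    finally have dx: "dist x' a \<le> e / c / (ratio t * rmin)" .
    have "D x (foldr g (t @ [i]) a) \<le> weight (t @ [i]) * D x' a"
      using D_scale[OF ti x'(1), of a] x' h PK by auto
    also have "\<dots> \<le> weight t * D x' a"
      using weight_append_le[of t "[i]"] h D_nonneg by (intro mult_right_mono) auto
    also have "\<dots> \<le> weight t * (C2 * dist x' a)"
      using C2' h x' pos by (intro mult_left_mono) auto
    also have "\<dots> \<le> weight t * (C2 * (e / c / (ratio t * rmin)))"
      using dx C2 pos by (intro mult_left_mono) auto
    finally show ?thesis by (simp add: C4_def mult_ac)
  qed
  show ?thesis
  proof (intro exI[of _ C] conjI C(1) ballI impI)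
    fix w x y assume w: "w \<in> lists I" and x: "x \<in> cell w" and y: "y \<in> K" and dist: "dist x y \<le>
        L * ratio w"
    show "D x y \<le> C * weight w"
    proof (cases "y \<in> cell w")
      case True
      then have "D x y \<le> 1 * weight w" using D_cell w x by auto
      also have "\<dots> \<le> C * weight w" using C weight_pos[OF w] by (intro mult_right_mono) auto
      finally show ?thesis .
    next
      case False
      define Q where "Q = (\<lambda>u. prefix u w \<and> y \<in> cell u)"
      have "Q []" using y by (auto simp: Q_def)
      moreover have "\<forall>u. Q u \<longrightarrow> length u < Suc (length w)"
        by (auto simp: Q_def le_imp_less_Suc prefix_length_le)
      ultimately obtain t where t: "Q t" and max: "\<And>u'. Q u' \<Longrightarrow> length u' \<le> length t"
        using ex_has_greatest_nat[of Q "[]" length "Suc (length w)"] by auto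
      obtain v where v: "w = t @ v" using t by (auto simp: Q_def prefix_def)
      have "v \<noteq> []" using v t False by (auto simp: Q_def)
      then obtain i v' where iv: "v = i # v'" by (cases v) auto
      have mem: "t \<in> lists I" "i \<in> I" "v' \<in> lists I" "i # v' \<in> lists I" using w v iv by auto
      have "\<not> Q (t @ [i])" using max[of "t @ [i]"] by auto
      then have ny: "y \<notin> cell (t @ [i])" using v iv by (auto simp: Q_def)
      obtain j where j: "j \<in> I" "y \<in> cell (t @ [j])"
        using cell_cover[of y t] t mem by (auto simp: Q_def)
      have ij: "i \<noteq> j" using ny j by auto
      have xi: "x \<in> cell (t @ [i])" using x v iv cell_append_subset[of v' "t @ [i]"] mem by auto
      have pos: "0 < ratio t" "0 < weight t" using mem ratio_pos weight_pos by auto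
      have dist': "dist x y \<le> L * (ratio t * ratio (i # v'))" using dist v iv by (simp add: mult_ac)
      have "\<delta> * ratio t \<le> dist x y \<or> pinched t i j x y"
        using d'[rule_format, OF mem(1,2) j(1) xi j(2) ij] .
      then have "D x y \<le> weight t * (C * weight (i # v'))"
      proof
        assume "\<delta> * ratio t \<le> dist x y"
        then have "\<delta> * ratio t \<le> (L * ratio (i # v')) * ratio t" using dist' by (simp add: mult_ac)
        then have "\<delta> \<le> L * ratio (i # v')" using pos by (simp only: mult_le_cancel_right_pos)
        then have "\<delta> / L \<le> ratio (i # v')" using L by (simp add: field_simps)
        then have "C1 \<le> weight (i # v')" using C1' mem by blast
        then have "1 \<le> 1 / C1 * weight (i # v')" using C1 by (simp add: field_simps)
        also have "\<dots> \<le> C * weight (i # v')" using C weight_pos[OF mem(4)]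
          by (intro mult_right_mono) auto
        finally have "weight t * 1 \<le> weight t * (C * weight (i # v'))" using pos
          by (intro mult_left_mono) auto
        moreover have "D x y \<le> weight t"
          using D_cell[OF mem(1), of x y] t xi cell_append_subset[of "[i]" t] mem
            by (auto simp: Q_def)
        ultimately show ?thesis by simp
      next
        assume "pinched t i j x y"
        then obtain a b where ab: "a \<in> P" "b \<in> P" "foldr g (t @ [i]) a = foldr g (t @ [j]) b"
          "c * dist x (foldr g (t @ [i]) a) \<le> dist x y" "c * dist y (foldr g (t @ [j]) b) \<le>
              dist x y"
          unfolding pinched_def by blast
        define z where "z = foldr g (t @ [i]) a"
        have zK: "z \<in> K" unfolding z_def using ab mem PK by (intro foldr_in_K) auto
        have xK: "x \<in> K" using x cell_subset_K w by blast
        have "D x z \<le> weight t / ratio t * C4 * dist x y"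
          unfolding z_def using vertex mem ab xi by blast
        moreover have "D y z \<le> weight t / ratio t * C4 * dist x y"
          unfolding z_def ab(3) using vertex mem ab j by blast
        ultimately have "D x z + D z y \<le>
            weight t / ratio t * C4 * dist x y + weight t / ratio t * C4 * dist x y"
          unfolding D_commute[of z y] by (rule add_mono)
        then have "D x y \<le> 2 * (weight t / ratio t * C4) * dist x y"
          using D_triangle[OF xK zK y] by (simp add: mult_ac)
        also have "\<dots> \<le> 2 * (weight t / ratio t * C4) * (L * (ratio t * ratio (i # v')))"
          using dist' C4 pos by (intro mult_left_mono) auto
        also have "\<dots> = weight t * (2 * C4 * L) * ratio (i # v')" using pos by simp
        also have "\<dots> \<le> weight t * (2 * C4 * L) * (C3 * weight (i # v'))"
        proof -
          have "dist x (foldr g (t @ [i]) a) \<le> (L / c) * ratio (t @ i # v')"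
            using ab(4) dist c_pos v iv by (simp add: field_simps)
          then have "ratio (i # v') \<le> C3 * weight (i # v')" using C3' mem ab x v iv by blast
          then show ?thesis using pos C4 L by (intro mult_left_mono) auto
        qed
        also have "\<dots> = weight t * ((2 * C4 * L * C3) * weight (i # v'))" by simp
        also have "\<dots> \<le> weight t * (C * weight (i # v'))"
          using C pos weight_pos[OF mem(4)] by (intro mult_left_mono mult_right_mono) auto
        finally show ?thesis .
      qed
      then show ?thesis using v iv by (simp add: mult_ac)
    qed
  qed
qed


text \<open>The test function for the lower bound is the truncated distance to \<open>x\<close>, interpolated by \<open>R k\<close> in
  the cells at which the contraction ratio first drops below a given \<open>s\<close>.\<close>

definition Stop :: "real \<Rightarrow> 'i list set" where
  "Stop s = {w \<in> lists I. ratio w \<le> s \<and> (\<forall>u v. w = u @ v \<longrightarrow> v \<noteq> [] \<longrightarrow> s < ratio u)}"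

definition stop_address :: "real \<Rightarrow> 'a \<Rightarrow> 'i list \<times> 'a" where
  "stop_address s x = (SOME p. fst p \<in> Stop s \<and> snd p \<in> K \<and> foldr g (fst p) (snd p) = x)"

definition R_stop :: "nat \<Rightarrow> real \<Rightarrow> ('a \<Rightarrow> real) \<Rightarrow> 'a \<Rightarrow> real" where
  "R_stop k s u x = R k (u \<circ> foldr g (fst (stop_address s x))) (snd (stop_address s x))"

section \<open>Stopping words and interpolation inside their cells\<close>

lemma Stop_prefix:
  assumes w: "w \<in> lists I" "ratio w \<le> s"
  obtains u v where "u \<in> Stop s" "v \<in> lists I" "w = u @ v"
proof -
  define Q where "Q = (\<lambda>u. prefix u w \<and> ratio u \<le> s)"
  have "Q w" using w by (simp add: Q_def)
  then obtain u where u: "Q u" and min: "\<And>u'. Q u' \<Longrightarrow> length u \<le> length u'"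
    using ex_has_least_nat[of Q w length] by blast
  obtain v where v: "w = u @ v" using u by (auto simp: Q_def prefix_def)
  have "s < ratio a" if "u = a @ b" "b \<noteq> []" for a b
  proof (rule ccontr)
    assume "\<not> s < ratio a"
    then have "Q a" using that v by (auto simp: Q_def)
    then show False using min[of a] that by auto
  qed
  then have "u \<in> Stop s" using u v w by (auto simp: Stop_def Q_def)
  then show ?thesis using that v w by auto
qed

lemma Stop_cover:
  assumes "x \<in> K" "0 < s" "s \<le> 1"
  obtains w y where "w \<in> Stop s" "y \<in> K" "foldr g w y = x"
proof -
  obtain w where w: "w \<in> lists I" "x \<in> cell w" "ratio w \<le> s"
    using cell_extend[of x "[]" s] assms by auto
  then obtain u v where uv: "u \<in> Stop s" "v \<in> lists I" "w = u @ v" using Stop_prefix by blast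
  then have "x \<in> cell u" using w cell_append_subset[of v u] by auto
  then show ?thesis using that uv by (auto simp: cell_def)
qed

lemma stop_address:
  assumes "x \<in> K" "0 < s" "s \<le> 1"
  shows "fst (stop_address s x) \<in> Stop s \<and> snd (stop_address s x) \<in> K \<and>
      foldr g (fst (stop_address s x)) (snd (stop_address s x)) = x"
  unfolding stop_address_def
proof (rule someI_ex)
  obtain w y where "w \<in> Stop s" "y \<in> K" "foldr g w y = x" using Stop_cover[OF assms] .
  then show "\<exists>p. fst p \<in> Stop s \<and> snd p \<in> K \<and> foldr g (fst p) (snd p) = x"
    by (intro exI[of _ "(w, y)"]) auto
qed

lemma Stop_lists: "w \<in> Stop s \<Longrightarrow> w \<in> lists I"
  by (simp add: Stop_def)

lemma Stop_ratio: "w \<in> Stop s \<Longrightarrow> s \<le> 1 \<Longrightarrow> 0 < s \<Longrightarrow> rmin * s \<le> ratio w"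
proof (cases w rule: rev_cases)
  case Nil
  assume "w \<in> Stop s" "s \<le> 1" "0 < s"
  moreover have "rmin * s \<le> 1" using \<open>s \<le> 1\<close> \<open>0 < s\<close> rmin(1,2) by (intro mult_le_one) auto
  ultimately show ?thesis using Nil by simp
next
  case (snoc u i)
  assume w: "w \<in> Stop s" "s \<le> 1" "0 < s"
  then have "s < ratio u" "i \<in> I" using snoc by (auto simp: Stop_def)
  then have "rmin * s \<le> r i * ratio u"
    using rmin w r_pos[of i] by (intro mult_mono) auto
  then show ?thesis using snoc by (simp add: mult_ac)
qed

text \<open>Different stopping words are parallel. A point in two stopping cells therefore comes
  from \<open>P\<close> in both of them, where \<open>R k\<close> does not change values.\<close>

lemma R_stop_word:
  assumes w: "w \<in> Stop s" and y: "y \<in> K" and s: "0 < s" "s \<le> 1"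
  shows "R_stop k s u (foldr g w y) = R k (u \<circ> foldr g w) y"
proof -
  define v z where "v = fst (stop_address s (foldr g w y))" and "z =
      snd (stop_address s (foldr g w y))"
  have wl: "w \<in> lists I" using w Stop_lists by auto
  have d: "v \<in> Stop s" "z \<in> K" "foldr g v z = foldr g w y"
    using stop_address[OF foldr_in_K[OF wl y] s] by (auto simp: v_def z_def)
  have vl: "v \<in> lists I" using d Stop_lists by auto
  show ?thesis
  proof (cases "v = w")
    case True
    then have "z = y" using d foldr_inj[OF wl] by auto
    then show ?thesis using True by (simp add: R_stop_def flip: v_def z_def)
  next
    case False
    have "parallel v w"
    proof (rule parallelI)
      show "\<not> prefix v w"
      proof
        assume "prefix v w"
        then obtain b where b: "w = v @ b" by (auto simp: prefix_def)
        then have "s < ratio v" using w False by (auto simp: Stop_def)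
        then show False using d by (simp add: Stop_def)
      qed
      show "\<not> prefix w v"
      proof
        assume "prefix w v"
        then obtain b where b: "v = w @ b" by (auto simp: prefix_def)
        then have "s < ratio w" using d False by (auto simp: Stop_def)
        then show False using w by (simp add: Stop_def)
      qed
    qed
    then obtain t i a j b where t: "i \<noteq> j" "v = t @ i # a" "w = t @ j # b"
      using parallel_decomp by blast
    have "z \<in> P" using P_meet_word[of t i a j b z y] t vl wl d y by auto
    moreover have "y \<in> P" using P_meet_word[of t j b i a y z] t vl wl d y by auto
    ultimately show ?thesis using d(3) by (simp add: R_stop_def R_P flip: v_def z_def)
  qed
qed

lemma R_stop_range:
  assumes "w \<in> Stop s" "y \<in> K" "0 < s" "s \<le> 1" "\<And>a. a \<in> P \<Longrightarrow>
      m \<le> u (foldr g w a) \<and> u (foldr g w a) \<le> M"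
  shows "m \<le> R_stop k s u (foldr g w y) \<and> R_stop k s u (foldr g w y) \<le> M"
  unfolding R_stop_word[OF assms(1-4)] by (rule R_range) (use assms in auto)

text \<open>The interpolated function differs from 1 only near \<open>x\<close>, and cells there
  that are not below the stopping scale have weight at least \<open>weight w / C\<close> by
  \<open>weight_compare\<close>. Multiplied by \<open>weight w / C\<close>, it is therefore
  admissible, and it still separates \<open>x\<close> from \<open>y\<close> by half of this
  factor.\<close>

lemma D_lower:
  assumes l: "0 < l"
  shows "\<exists>C>0. \<forall>w\<in>lists I. \<forall>x\<in>cell w. \<forall>y\<in>K. l * ratio w \<le> dist x y \<longrightarrow> C * weight w \<le> D x y"
proof -
  \<comment> \<open>Stopping words have ratio at least \<open>rmin * s\<close>, which equals
    \<open>l' * ratio w\<close> for the \<open>s\<close> chosen below.\<close>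
  define l' where "l' = rmin * (l / (4 * diam_bound))"
  have l': "0 < l'" using l rmin(1) diam_bound_pos by (simp add: l'_def)
  obtain C where C: "C > 0" and C': "\<forall>u\<in>lists I. \<forall>v\<in>lists I. \<forall>x\<in>cell u. \<forall>y\<in>cell v.
     dist x y \<le> (2 * l) * ratio u \<longrightarrow> l' * ratio u \<le> ratio v \<longrightarrow> weight u \<le> C * weight v"
    by (rule exE[OF weight_compare[OF mult_pos_pos[OF zero_less_numeral l] l']], erule conjE, rule that)
  show ?thesis
  proof (intro exI[of _ "1 / (2 * C)"] conjI ballI impI)
    show "0 < 1 / (2 * C)" using C by simp
    fix w x y assume w: "w \<in> lists I" and x: "x \<in> cell w" and y: "y \<in> K" and dist: "l * ratio w \<le>
        dist x y"
    define e where "e = l * ratio w"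
    \<comment> \<open>Stopping cells then have diameter at most \<open>e / 4\<close>, so
      interpolation moves the values 0 at \<open>x\<close> and 1 at \<open>y\<close> by at most
      1/4.\<close>
    define s where "s = e / (4 * diam_bound)"
    have xK: "x \<in> K" using x w cell_subset_K by blast
    have e: "0 < e" using l ratio_pos[OF w] by (simp add: e_def)
    have e4: "diam_bound * s = e / 4" using diam_bound_pos by (simp add: s_def)
    have s: "0 < s" "s \<le> 1"
      using e diam_bound_pos dist dist_K[OF xK y] by (auto simp: s_def e_def)
    have rmin_s: "rmin * s = l' * ratio w" by (simp add: s_def e_def l'_def)
    define u where "u = (\<lambda>p. min 1 (dist p x / e))"
    have u01: "0 \<le> u p" "u p \<le> 1" for p using e by (auto simp: u_def)
    have u_less: "dist p x < e" if "u p < 1" for p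
      using that e by (simp add: u_def min_less_iff_disj)
    have stop_diam: "dist p q \<le> e / 4" if "v \<in> Stop s" "p \<in> cell v" "q \<in> cell v" for v p q
    proof -
      have "dist p q \<le> diam_bound * ratio v" using dist_cell that Stop_lists by blast
      also have "\<dots> \<le> diam_bound * s" using that diam_bound_pos
        by (intro mult_left_mono) (auto simp: Stop_def)
      finally show ?thesis using e4 by simp
    qed
    have compare: "weight w \<le> C * weight v"
      if "v \<in> lists I" "q \<in> cell v" "dist q x \<le> 2 * e" "l' * ratio w \<le> ratio v" for v q
      using C'[rule_format, OF w that(1) x that(2)] that by (simp add: e_def dist_commute mult_ac)
    have admissible: "(\<lambda>p. R_stop k s u p * (weight w / C)) \<in> admissible k" for k
      unfolding admissible_def
    proof (intro CollectI ballI impI)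
      fix t p q assume t: "t \<in> lists I" "length t \<le> k" and p: "p \<in> K" and q: "q \<in> K"
      let ?F = "R_stop k s u"
      have range: "0 \<le> ?F z \<and> ?F z \<le> 1" if z: "z \<in> K" for z
      proof -
        obtain v y where "v \<in> Stop s" "y \<in> K" "foldr g v y = z" using Stop_cover[OF z s] .
        then show ?thesis using R_stop_range[of v s y 0 u 1 k] s u01 by auto
      qed
      have key: "\<bar>?F (foldr g t p) - ?F (foldr g t q)\<bar> * weight w \<le> C * weight t"
      proof (cases "ratio t \<le> s")
        case True
        then obtain v v' where v: "v \<in> Stop s" "v' \<in> lists I" "t = v @ v'" using Stop_prefix t
          by blast
        have vl: "v \<in> lists I" using v Stop_lists by auto
        have eq: "?F (foldr g t z) = R k (u \<circ> foldr g v) (foldr g v' z)" if "z \<in> K" for z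
          using R_stop_word[OF v(1) foldr_in_K[OF v(2) that] s] v by simp
        show ?thesis
        proof (cases "\<forall>a\<in>P. u (foldr g v a) = 1")
          \<comment> \<open>All boundary values are 1, so the interpolation is constant on this
            stopping cell.\<close>
          case True
          then have "\<bar>R k (u \<circ> foldr g v) (foldr g v' p) - R k (u \<circ> foldr g v) (foldr g v' q)\<bar> \<le>
              weight v' * 0"
            using t v p q by (intro R_osc) auto
          then show ?thesis using eq p q C weight_pos[OF t(1)] by simp
        next
          case False
          then obtain a where "a \<in> P" "u (foldr g v a) \<noteq> 1" by blast
          then have a: "a \<in> P" "u (foldr g v a) < 1" using u01(2)[of "foldr g v a"] by auto
          then have "dist (foldr g v a) x < e" using u_less by blast
          then have "weight w \<le> C * weight v"
            using a PK e Stop_ratio[OF v(1) s(2,1)] rmin_s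
              by (intro compare[OF vl, of "foldr g v a"]) auto
          then have "weight v' * weight w \<le> weight v' * (C * weight v)" using weight_pos[OF v(2)]
            by (intro mult_left_mono) auto
          moreover have "\<bar>R k (u \<circ> foldr g v) (foldr g v' p) - R k (u \<circ> foldr g v) (foldr g v' q)\<bar> \<le>
              weight v' * 1"
          proof (rule R_osc)
            show "\<bar>(u \<circ> foldr g v) a - (u \<circ> foldr g v) b\<bar> \<le> 1" for a b
              using u01[of "foldr g v a"] u01[of "foldr g v b"] by (auto simp: abs_le_iff)
          qed (use t v p q in auto)
          then have "\<bar>R k (u \<circ> foldr g v) (foldr g v' p) - R k (u \<circ> foldr g v) (foldr g v' q)\<bar> * weight w \<le> weight v' * weight w"
            using weight_pos[OF w] by (intro mult_right_mono) auto
          ultimately have "\<bar>R k (u \<circ> foldr g v) (foldr g v' p) - R k (u \<circ> foldr g v) (foldr g v' q)\<bar> * weight w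
              \<le> weight v' * (C * weight v)" by linarith
          then show ?thesis unfolding eq[OF p] eq[OF q] using v by (simp add: mult_ac)
        qed
      next
        case False
        show ?thesis
        proof (cases "?F (foldr g t p) = 1 \<and> ?F (foldr g t q) = 1")
          case True
          then show ?thesis using C weight_pos[OF t(1)] by simp
        next
          \<comment> \<open>The ratio of \<open>t\<close> is above the stopping scale, and its cell
            contains a point where the function is below 1. Such a point is within
            \<open>e + e / 4\<close> of \<open>x\<close>, so \<open>weight t\<close> is large enough
            to absorb an oscillation of 1.\<close>
          case F: False
          then obtain z where z: "z \<in> cell t" "?F z < 1"
            using range[OF foldr_in_K[OF t(1) p]] range[OF foldr_in_K[OF t(1) q]] p q by force
          have zK: "z \<in> K" using z t cell_subset_K by blast
          obtain v z' where v: "v \<in> Stop s" "z' \<in> K" "foldr g v z' = z" using Stop_cover[OF zK s] .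
          have "\<exists>a\<in>P. u (foldr g v a) < 1"
          proof (rule ccontr)
            assume "\<not> ?thesis"
            then have "1 \<le> ?F (foldr g v z') \<and> ?F (foldr g v z') \<le> 1"
              using u01 by (intro R_stop_range v s) (auto simp: not_less)
            then show False using z v by simp
          qed
          then obtain a where a: "a \<in> P" "u (foldr g v a) < 1" by blast
          then have "dist (foldr g v a) x < e" using u_less by blast
          moreover have "dist z (foldr g v a) \<le> e / 4" using stop_diam[OF v(1)] v a PK by blast
          ultimately have "dist z x \<le> 2 * e" using dist_triangle[of z x "foldr g v a"] e by linarith
          moreover have "rmin * s \<le> s" using rmin(1,2) s by (intro mult_left_le_one_le) auto
          then have "rmin * s \<le> ratio t" using False by linarith
          ultimately have "weight w \<le> C * weight t" using z rmin_s by (intro compare[OF t(1)]) auto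
          moreover have "\<bar>?F (foldr g t p) - ?F (foldr g t q)\<bar> \<le> 1"
            using range[OF foldr_in_K[OF t(1) p]] range[OF foldr_in_K[OF t(1) q]]
              by (auto simp: abs_le_iff)
          then have "\<bar>?F (foldr g t p) - ?F (foldr g t q)\<bar> * weight w \<le> weight w"
            using weight_pos[OF w] by (intro mult_left_le_one_le) auto
          ultimately show ?thesis by linarith
        qed
      qed
      have "\<bar>?F (foldr g t p) * (weight w / C) - ?F (foldr g t q) * (weight w / C)\<bar>
          = \<bar>?F (foldr g t p) - ?F (foldr g t q)\<bar> * weight w / C"
        using C weight_pos[OF w] by (simp add: left_diff_distrib[symmetric] diff_divide_distrib[symmetric] abs_mult)
      also have "\<dots> \<le> weight t" using key C by (simp add: divide_le_eq mult.commute)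
      finally show "\<bar>?F (foldr g t p) * (weight w / C) - ?F (foldr g t q) * (weight w / C)\<bar> \<le>
          weight t" .
    qed
    have Fx: "R_stop k s u x \<le> 1 / 4" for k
    proof -
      obtain v x' where v: "v \<in> Stop s" "x' \<in> K" "foldr g v x' = x" using Stop_cover[OF xK s] .
      have "u (foldr g v a) \<le> 1 / 4" if "a \<in> P" for a
      proof -
        have "dist (foldr g v a) x \<le> e / 4" using stop_diam[OF v(1)] v that PK by blast
        then have "dist (foldr g v a) x / e \<le> 1 / 4" using e by (simp add: field_simps)
        then show ?thesis unfolding u_def by linarith
      qed
      then show ?thesis using R_stop_range[of v s x' 0 u "1/4" k] v s u01 by auto
    qed
    have Fy: "3 / 4 \<le> R_stop k s u y" for k
    proof -
      obtain v y' where v: "v \<in> Stop s" "y' \<in> K" "foldr g v y' = y" using Stop_cover[OF y s] .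
      have "3 / 4 \<le> u (foldr g v a)" if "a \<in> P" for a
      proof -
        have "dist y (foldr g v a) \<le> e / 4" using stop_diam[OF v(1)] v that PK by blast
        then have "3 / 4 * e \<le> dist (foldr g v a) x"
          using dist dist_triangle[of x y "foldr g v a"] by (simp add: e_def dist_commute)
        then show ?thesis using e by (simp add: u_def field_simps)
      qed
      then show ?thesis using R_stop_range[of v s y' "3/4" u 1 k] v s u01 by auto
    qed
    show "1 / (2 * C) * weight w \<le> D x y"
    proof (rule D_ge[OF xK y])
      fix k
      have "1 / 2 * (weight w / C) \<le> (R_stop k s u y - R_stop k s u x) * (weight w / C)"
        using Fx[of k] Fy[of k] C weight_pos[OF w] by (intro mult_right_mono) auto
      also have "\<dots> = - (R_stop k s u x * (weight w / C) - R_stop k s u y * (weight w / C))"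
        by (simp only: left_diff_distrib minus_diff_eq)
      also have "\<dots> \<le> \<bar>R_stop k s u x * (weight w / C) - R_stop k s u y * (weight w / C)\<bar>"
        by (rule abs_ge_minus_self)
      also have "\<dots> \<le> D_level k x y" using D_level_ge[OF admissible xK y] .
      finally show "1 / (2 * C) * weight w \<le> D_level k x y" by simp
    qed
  qed
qed

end

section \<open>Quasisymmetry and Hausdorff measure\<close>

lemma powr_sum_homeomorphism:
  fixes A b p q :: real
  assumes "0 < A" "0 < b" "0 < p" "0 < q"
  defines "\<eta> \<equiv> \<lambda>t. A * ((b * t) powr p + (b * t) powr q)"
  shows "strict_mono_on {0..} \<eta>" "\<exists>\<eta>'. homeomorphism {0..} {0..} \<eta> \<eta>'"
proof -
  show mono: "strict_mono_on {0..} \<eta>"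
  proof (rule strict_mono_onI)
    fix x y :: real assume "x \<in> {0..}" "y \<in> {0..}" "x < y"
    then have "(b * x) powr p < (b * y) powr p" "(b * x) powr q < (b * y) powr q"
      using assms(1-4) by (auto intro!: powr_less_mono2)
    then show "\<eta> x < \<eta> y"
      unfolding \<eta>_def using assms(1) by (intro mult_strict_left_mono add_strict_mono)
  qed
  have cont: "continuous_on {0..} \<eta>"
    unfolding \<eta>_def using assms(1-4)
    by (intro continuous_on_mult_left continuous_on_add continuous_on_powr' continuous_on_const continuous_on_id) auto
  have "\<eta> ` {0..} = {0..}"
  proof (intro equalityI subsetI)
    fix y :: real assume y: "y \<in> {0..}"
    \<comment> \<open>The first power alone already gives the value \<open>y\<close> at
      \<open>T\<close>.\<close>
    define T where "T = (y / A) powr (1 / p) / b"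
    have T: "0 \<le> T" using assms by (simp add: T_def)
    have "(b * T) powr p = y / A" using assms y by (simp add: T_def powr_powr)
    then have "y \<le> \<eta> T" using assms by (simp add: \<eta>_def distrib_left)
    moreover have "\<eta> 0 = 0" by (simp add: \<eta>_def)
    moreover have "continuous_on {0..T} \<eta>" using cont by (rule continuous_on_subset) auto
    ultimately obtain x where "0 \<le> x" "\<eta> x = y" using IVT'[of \<eta> 0 y T] T y by auto
    then show "y \<in> \<eta> ` {0..}" by auto
  next
    fix y assume "y \<in> \<eta> ` {0..}"
    then show "y \<in> {0..}" using assms by (auto simp: \<eta>_def)
  qed
  then show "\<exists>\<eta>'. homeomorphism {0..} {0..} \<eta> \<eta>'"
    using homeomorphism_into_1d[OF _ cont] strict_mono_on_imp_inj_on[OF mono]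
    by (simp add: convex_imp_path_connected)
qed

lemma mtopology_eqI:
  assumes 1: "Metric_space M d1" and 2: "Metric_space M d2"
    and 12: "\<And>x e. x \<in> M \<Longrightarrow> 0 < e \<Longrightarrow> \<exists>\<delta>>0. \<forall>y\<in>M. d1 x y < \<delta> \<longrightarrow> d2 x y < e"
    and 21: "\<And>x e. x \<in> M \<Longrightarrow> 0 < e \<Longrightarrow> \<exists>\<delta>>0. \<forall>y\<in>M. d2 x y < \<delta> \<longrightarrow> d1 x y < e"
  shows "Metric_space.mtopology M d1 = Metric_space.mtopology M d2"
proof -
  interpret M1: Metric_space M d1 by fact
  interpret M2: Metric_space M d2 by fact
  have "(\<exists>r>0. M1.mball x r \<subseteq> U) = (\<exists>r>0. M2.mball x r \<subseteq> U)" if x: "x \<in> M" for x U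
  proof
    assume "\<exists>r>0. M1.mball x r \<subseteq> U"
    then obtain e where e: "e > 0" "M1.mball x e \<subseteq> U" by blast
    then obtain \<delta> where "\<delta> > 0" "\<forall>y\<in>M. d2 x y < \<delta> \<longrightarrow> d1 x y < e" using 21[OF x e(1)] by blast
    then show "\<exists>r>0. M2.mball x r \<subseteq> U" using e x by (intro exI[of _ \<delta>]) auto
  next
    assume "\<exists>r>0. M2.mball x r \<subseteq> U"
    then obtain e where e: "e > 0" "M2.mball x e \<subseteq> U" by blast
    then obtain \<delta> where "\<delta> > 0" "\<forall>y\<in>M. d1 x y < \<delta> \<longrightarrow> d2 x y < e" using 12[OF x e(1)] by blast
    then show "\<exists>r>0. M1.mball x r \<subseteq> U" using e x by (intro exI[of _ \<delta>]) auto
  qed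
  then show ?thesis
    unfolding topology_eq M1.openin_mtopology M2.openin_mtopology by blast
qed

lemma ediam_le: "(\<And>x y. x \<in> U \<Longrightarrow> y \<in> U \<Longrightarrow> d x y \<le> B) \<Longrightarrow> ediam d U \<le> ennreal B"
  unfolding ediam_def by (intro SUP_least ennreal_leI)

context weighted_system
begin

text \<open>The window of scales is as narrow as cells allow: \<open>cell_extend\<close> meets a
  prescribed ratio only up to the factor \<open>rmin\<close>.\<close>

lemma D_comparable:
  "\<exists>A>0. \<forall>w\<in>lists I. \<forall>x\<in>cell w. \<forall>y\<in>K. diam_bound * ratio w \<le> dist x y \<longrightarrow>
      dist x y \<le> diam_bound / rmin * ratio w \<longrightarrow>
     D x y \<le> A * weight w \<and> weight w \<le> A * D x y"
proof -
  obtain C1 where C1: "C1 > 0" and C1': "\<forall>w\<in>lists I. \<forall>x\<in>cell w. \<forall>y\<in>K. dist x y \<le>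
      diam_bound / rmin * ratio w \<longrightarrow> D x y \<le> C1 * weight w"
    by (rule exE[OF D_upper[OF divide_pos_pos[OF diam_bound_pos rmin(1)]]], erule conjE, rule that)
  obtain C2 where C2: "C2 > 0" and C2': "\<forall>w\<in>lists I. \<forall>x\<in>cell w. \<forall>y\<in>K. diam_bound * ratio w \<le>
      dist x y \<longrightarrow> C2 * weight w \<le> D x y"
    by (rule exE[OF D_lower[OF diam_bound_pos]], erule conjE, rule that)
  show ?thesis
  proof (intro exI[of _ "C1 + 1 / C2"] conjI ballI impI)
    show "0 < C1 + 1 / C2" using C1 C2 by (simp add: add_pos_pos)
    fix w x y assume h: "w \<in> lists I" "x \<in> cell w" "y \<in> K" "diam_bound * ratio w \<le>
        dist x y" "dist x y \<le> diam_bound / rmin * ratio w"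
    have "D x y \<le> C1 * weight w" using C1' h by blast
    also have "\<dots> \<le> (C1 + 1 / C2) * weight w" using C2 weight_pos[OF h(1)]
      by (intro mult_right_mono) auto
    finally show "D x y \<le> (C1 + 1 / C2) * weight w" .
    have "C2 * weight w \<le> D x y" using C2' h by blast
    then have "weight w \<le> 1 / C2 * D x y" using C2 by (simp add: field_simps)
    also have "\<dots> \<le> (C1 + 1 / C2) * D x y" using C1 D_nonneg by (intro mult_right_mono) auto
    finally show "weight w \<le> (C1 + 1 / C2) * D x y" .
  qed
qed

text \<open>Extending a given \<open>w\<close> lets two scales at one point be compared through the
  weight of the added letters alone.\<close>

lemma cell_at_scale:
  assumes "w \<in> lists I" "x \<in> cell w" "0 < d" "d \<le> diam_bound / rmin * ratio w"
  obtains v where "v \<in> lists I" "x \<in> cell (w @ v)" "diam_bound * ratio (w @ v) \<le> d" "d \<le>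
      diam_bound / rmin * ratio (w @ v)"
proof (cases "d \<le> diam_bound * ratio w")
  case True
  obtain v where v: "v \<in> lists I" "x \<in> cell (w @ v)" "rmin * (d / diam_bound) \<le>
      ratio (w @ v)" "ratio (w @ v) \<le> d / diam_bound"
    by (rule cell_extend[OF assms(2,1), of "d / diam_bound"]) (use assms True diam_bound_pos in \<open>auto simp: field_simps\<close>)
  have "diam_bound * ratio (w @ v) \<le> d" using v(4) diam_bound_pos
    by (simp only: pos_le_divide_eq mult.commute)
  moreover have "d * rmin \<le> diam_bound * ratio (w @ v)" using v(3) diam_bound_pos
    by (simp add: pos_divide_le_eq mult_ac)
  then have "d \<le> diam_bound * ratio (w @ v) / rmin" using rmin(1) by (simp only: pos_le_divide_eq)
  ultimately show ?thesis using that[of v] v by simp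
next
  case False
  then show ?thesis using that[of "[]"] assms by auto
qed

text \<open>Shows that \<open>D\<close> separates points and induces the original topology.\<close>

lemma D_Holder:
  "\<exists>C>0. \<exists>p>0. \<exists>q>0. \<forall>x\<in>K. \<forall>y\<in>K. D x y \<le> C * dist x y powr p \<and> dist x y powr q \<le> C * D x y"
proof -
  obtain A where A: "A > 0" and A': "\<forall>w\<in>lists I. \<forall>x\<in>cell w. \<forall>y\<in>K. diam_bound * ratio w \<le> dist x y \<longrightarrow>
      dist x y \<le> diam_bound / rmin * ratio w \<longrightarrow>
     D x y \<le> A * weight w \<and> weight w \<le> A * D x y"
    by (rule exE[OF D_comparable], erule conjE, rule that)
  obtain p where p: "p > 0" "\<forall>w\<in>lists I. weight w \<le> ratio w powr p" using weight_le_ratio_powr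
    by blast
  obtain q where q: "q \<ge> 1" "\<forall>w\<in>lists I. ratio w powr q \<le> weight w" using weight_ge_ratio_powr
    by blast
  define B where "B = (diam_bound / rmin) powr q"
  have B: "0 < B" using diam_bound_pos rmin(1) by (simp add: B_def)
  have "D x y \<le> (A + B * A) * dist x y powr p \<and> dist x y powr q \<le> (A + B * A) * D x y"
    if x: "x \<in> K" and y: "y \<in> K" for x y
  proof (cases "x = y")
    case True
    then show ?thesis by (simp add: D_refl)
  next
    case False
    have "diam_bound * 1 \<le> diam_bound * (1 / rmin)" using diam_bound_pos rmin(1,2)
      by (intro mult_left_mono) auto
    then have "dist x y \<le> diam_bound / rmin * ratio []" using dist_K[OF x y] by simp
    then obtain w where w: "w \<in> lists I" "x \<in> cell w" "diam_bound * ratio w \<le> dist x y" "dist x y \<le>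
        diam_bound / rmin * ratio w"
      using cell_at_scale[of "[]" x "dist x y"] x False by auto
    have pos: "0 < ratio w" "0 < weight w" using w ratio_pos weight_pos by auto
    have 1: "D x y \<le> A * weight w" "weight w \<le> A * D x y" using A' w y by blast+
    have "ratio w \<le> diam_bound * ratio w" using diam_bound_ge_1 pos by simp
    then have "ratio w \<le> dist x y" using w by linarith
    then have "ratio w powr p \<le> dist x y powr p" using w p pos by (intro powr_mono2) auto
    then have "A * weight w \<le> A * dist x y powr p" using p w A
      by (intro mult_left_mono) (auto intro: order_trans)
    moreover have "\<dots> \<le> (A + B * A) * dist x y powr p" using A B by (intro mult_right_mono) auto
    ultimately have U: "D x y \<le> (A + B * A) * dist x y powr p" using 1 by linarith
    have "dist x y powr q \<le> (diam_bound / rmin * ratio w) powr q" using w q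
      by (intro powr_mono2) auto
    also have "\<dots> = B * ratio w powr q" unfolding B_def by (rule powr_mult)
    also have "\<dots> \<le> B * (A * D x y)" using 1 q w B
      by (intro mult_left_mono) (auto intro: order_trans)
    also have "\<dots> \<le> (A + B * A) * D x y" using A D_nonneg[of x y] by (simp add: algebra_simps)
    finally show ?thesis using U by simp
  qed
  moreover have "0 < A + B * A" using A B by (simp add: add_pos_pos)
  ultimately show ?thesis using p q by (meson less_le_trans zero_less_one)
qed

section \<open>Topology and quasisymmetry of the new metric\<close>

lemma D_metric: "Metric_space K D"
proof
  obtain C p q where C: "C > 0" "q > 0" "\<forall>x\<in>K. \<forall>y\<in>K. D x y \<le> C * dist x y powr p \<and>
      dist x y powr q \<le> C * D x y"
    using D_Holder by blast
  fix x y assume xy: "x \<in> K" "y \<in> K"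
  show "D x y = 0 \<longleftrightarrow> x = y"
  proof
    assume "D x y = 0"
    then have "dist x y powr q \<le> 0" using C xy by (metis mult_zero_right)
    then show "x = y" using powr_gt_zero[of "dist x y" q] zero_le_dist[of x y]
      by (auto simp: less_le)
  qed (simp add: D_refl)
qed (auto simp: D_nonneg D_commute intro: D_triangle)

lemma mtopology_D: "Metric_space.mtopology K dist = Metric_space.mtopology K D"
proof (rule mtopology_eqI)
  show "Metric_space K dist" by unfold_locales (auto simp: dist_commute dist_triangle)
  show "Metric_space K D" by (rule D_metric)
  obtain C p q where C: "C > 0" "p > 0" "q > 0" "\<forall>x\<in>K. \<forall>y\<in>K. D x y \<le> C * dist x y powr p \<and>
      dist x y powr q \<le> C * D x y"
    using D_Holder by blast
  fix x and e :: real assume x: "x \<in> K" and e: "0 < e"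
  show "\<exists>\<delta>>0. \<forall>y\<in>K. dist x y < \<delta> \<longrightarrow> D x y < e"
  proof (intro exI[of _ "(e / C) powr (1 / p)"] conjI ballI impI)
    fix y assume y: "y \<in> K" "dist x y < (e / C) powr (1 / p)"
    then have "dist x y powr p < ((e / C) powr (1 / p)) powr p" using C
      by (intro powr_less_mono2) auto
    then have "C * dist x y powr p < e" using C e by (simp add: powr_powr field_simps)
    then show "D x y < e" using C x y by fastforce
  qed (use C e in auto)
  show "\<exists>\<delta>>0. \<forall>y\<in>K. D x y < \<delta> \<longrightarrow> dist x y < e"
  proof (intro exI[of _ "e powr q / C"] conjI ballI impI)
    fix y assume y: "y \<in> K" "D x y < e powr q / C"
    then have "C * D x y < e powr q" using C by (simp add: field_simps)
    then have "dist x y powr q < e powr q" using C x y by fastforce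
    then show "dist x y < e" using C e powr_less_cancel2
      by (metis zero_le_dist less_imp_le powr_mono2 not_less)
  qed (use C e in auto)
qed

text \<open>Take a cell at \<open>x\<close> of the size of the larger distance and extend it by
  \<open>v\<close> to the size of the smaller one. Up to a constant, the quotient of the two values
  of \<open>D\<close> is \<open>weight v\<close> or its inverse, while \<open>ratio v\<close> or its
  inverse is at most \<open>t / rmin\<close>.\<close>

theorem quasisymmetric_D: "quasisymmetric K dist K D id"
proof -
  obtain A where A: "A > 0" and A': "\<forall>w\<in>lists I. \<forall>x\<in>cell w. \<forall>y\<in>K. diam_bound * ratio w \<le> dist x y \<longrightarrow>
      dist x y \<le> diam_bound / rmin * ratio w \<longrightarrow>
     D x y \<le> A * weight w \<and> weight w \<le> A * D x y"
    by (rule exE[OF D_comparable], erule conjE, rule that)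
  obtain p where p: "p > 0" "\<forall>w\<in>lists I. weight w \<le> ratio w powr p" using weight_le_ratio_powr
    by blast
  obtain q where q: "q \<ge> 1" "\<forall>w\<in>lists I. ratio w powr q \<le> weight w" using weight_ge_ratio_powr
    by blast
  \<comment> \<open>\<open>A\<^sup>2\<close> stems from two uses of \<open>D_comparable\<close> and
    \<open>1 / rmin\<close> from the window of scales. The exponent \<open>p\<close> serves the case
    where \<open>y\<close> is at most as far from \<open>x\<close> as \<open>z\<close>, the exponent
    \<open>q\<close> the other case.\<close>
  define \<eta> where "\<eta> = (\<lambda>t. A\<^sup>2 * ((1 / rmin * t) powr p + (1 / rmin * t) powr q))"
  have eta: "strict_mono_on {0..} \<eta>" "\<exists>\<eta>'. homeomorphism {0..} {0..} \<eta> \<eta>'"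
    using powr_sum_homeomorphism[of "A\<^sup>2" "1 / rmin" p q] A rmin(1) p q by (auto simp: \<eta>_def)
  have root: "d \<le> diam_bound / rmin * ratio []" if "d \<le> diam_bound" for d
  proof -
    have "diam_bound * 1 \<le> diam_bound * (1 / rmin)" using diam_bound_pos rmin(1,2)
      by (intro mult_left_mono) auto
    then show ?thesis using that by simp
  qed
  have "D x y \<le> \<eta> t * D x z" if x: "x \<in> K" and y: "y \<in> K" and z: "z \<in> K" and t: "0 \<le> t"
    and d: "dist x y \<le> t * dist x z" for x y z t
  proof (cases "x = y")
    case True
    then show ?thesis using A D_nonneg by (simp add: D_refl \<eta>_def)
  next
    case False
    then have xz: "x \<noteq> z" using d by auto
    have d0: "0 < dist x y" "0 < dist x z" using False xz by auto
    have part: "\<eta> t \<ge> A\<^sup>2 * (1 / rmin * t) powr p" "\<eta> t \<ge> A\<^sup>2 * (1 / rmin * t) powr q"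
      by (auto simp: \<eta>_def distrib_left)
    show ?thesis
    proof (cases "dist x y \<le> dist x z")
      case True
      obtain w where w: "w \<in> lists I" "x \<in> cell w" "diam_bound * ratio w \<le> dist x z" "dist x z \<le>
          diam_bound / rmin * ratio w"
        using cell_at_scale[of "[]" x "dist x z"] x d0 root dist_K[OF x z] by auto
      obtain v where v: "v \<in> lists I" "x \<in> cell (w @ v)" "diam_bound * ratio (w @ v) \<le>
          dist x y" "dist x y \<le> diam_bound / rmin * ratio (w @ v)"
        using cell_at_scale[of w x "dist x y"] w d0 True by auto
      have pos: "0 < ratio w" "0 < weight w" "0 < ratio v" "0 < weight v"
        using v w ratio_pos weight_pos by auto
      have "diam_bound * ratio w * ratio v \<le> t * dist x z" using v(3) d by (simp add: mult_ac)
      also have "\<dots> \<le> t * (diam_bound / rmin * ratio w)" using w t by (intro mult_left_mono) auto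
      finally have "ratio v * (diam_bound * ratio w) \<le> (1 / rmin * t) * (diam_bound * ratio w)"
        by (simp add: mult_ac)
      then have "ratio v \<le> 1 / rmin * t" using diam_bound_pos pos
        by (simp only: mult_le_cancel_right_pos[of "diam_bound * ratio w"] mult_pos_pos)
      then have "ratio v powr p \<le> (1 / rmin * t) powr p" using p pos by (intro powr_mono2) auto
      then have pv: "weight v \<le> (1 / rmin * t) powr p" using p v by (auto intro: order_trans)
      have "D x y \<le> A * weight (w @ v)" using A'[rule_format, of "w @ v" x y] v w y by auto
      also have "\<dots> = A * weight v * weight w" by simp
      also have "\<dots> \<le> A * weight v * (A * D x z)" using A'[rule_format, of w x z] w z A pos
        by (intro mult_left_mono) auto
      also have "\<dots> = A\<^sup>2 * weight v * D x z" by (simp add: power2_eq_square)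
      also have "\<dots> \<le> A\<^sup>2 * (1 / rmin * t) powr p * D x z"
        using pv D_nonneg A by (intro mult_right_mono mult_left_mono) auto
      also have "\<dots> \<le> \<eta> t * D x z" using part D_nonneg by (intro mult_right_mono)
      finally show ?thesis .
    next
      case F: False
      obtain w where w: "w \<in> lists I" "x \<in> cell w" "diam_bound * ratio w \<le> dist x y" "dist x y \<le>
          diam_bound / rmin * ratio w"
        using cell_at_scale[of "[]" x "dist x y"] x d0 root dist_K[OF x y] by auto
      obtain v where v: "v \<in> lists I" "x \<in> cell (w @ v)" "diam_bound * ratio (w @ v) \<le>
          dist x z" "dist x z \<le> diam_bound / rmin * ratio (w @ v)"
        using cell_at_scale[of w x "dist x z"] w d0 F by auto
      have pos: "0 < ratio w" "0 < weight w" "0 < ratio v" "0 < weight v"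
        using v w ratio_pos weight_pos by auto
      have "diam_bound * ratio w \<le> t * dist x z" using w(3) d by simp
      also have "\<dots> \<le> t * (diam_bound / rmin * ratio (w @ v))" using v t
        by (intro mult_left_mono) auto
      finally have "1 * (diam_bound * ratio w) \<le> (1 / rmin * t * ratio v) * (diam_bound * ratio w)"
        by (simp add: mult_ac)
      then have "1 \<le> 1 / rmin * t * ratio v" using diam_bound_pos pos
        by (simp only: mult_le_cancel_right_pos[of "diam_bound * ratio w"] mult_pos_pos)
      then have "1 powr q \<le> (1 / rmin * t * ratio v) powr q" using q by (intro powr_mono2) auto
      also have "\<dots> = (1 / rmin * t) powr q * ratio v powr q" by (rule powr_mult)
      also have "\<dots> \<le> (1 / rmin * t) powr q * weight v" using q v by (intro mult_left_mono) auto
      finally have pv: "1 \<le> (1 / rmin * t) powr q * weight v" by simp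
      have "D x y \<le> A * weight w" using A'[rule_format, of w x y] w y by auto
      also have "\<dots> = A * weight w * 1" by simp
      also have "\<dots> \<le> A * weight w * ((1 / rmin * t) powr q * weight v)" using pv A pos
        by (intro mult_left_mono) auto
      also have "\<dots> = A * (1 / rmin * t) powr q * weight (w @ v)" by simp
      also have "\<dots> \<le> A * (1 / rmin * t) powr q * (A * D x z)"
        using A'[rule_format, of "w @ v" x z] v w z A by (intro mult_left_mono) auto
      also have "\<dots> = A\<^sup>2 * (1 / rmin * t) powr q * D x z" by (simp add: power2_eq_square)
      also have "\<dots> \<le> \<eta> t * D x z" using part D_nonneg by (intro mult_right_mono)
      finally show ?thesis .
    qed
  qed
  then show ?thesis
    unfolding quasisymmetric_def using eta by (auto simp: mtopology_D)
qed

section \<open>Vanishing of the Hausdorff measure\<close>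

lemma sum_words: "(\<Sum>w\<in>{w \<in> lists I. length w = n}. weight w powr s) = (\<Sum>i\<in>I. \<rho> i powr s) ^ n"
proof (induction n)
  case 0
  have "{w \<in> lists I. length w = 0} = {[]}" by auto
  then show ?case by simp
next
  case (Suc n)
  let ?W = "\<lambda>n. {w \<in> lists I. length w = n}"
  have "?W (Suc n) = (\<lambda>p. fst p # snd p) ` (I \<times> ?W n)"
    by (force simp: length_Suc_conv image_iff)
  moreover have "inj_on (\<lambda>p. fst p # snd p) (I \<times> ?W n)" by (auto simp: inj_on_def)
  ultimately have "(\<Sum>w\<in>?W (Suc n). weight w powr s) = (\<Sum>(i, w)\<in>I \<times> ?W n. weight (i # w) powr s)"
    by (simp add: sum.reindex o_def case_prod_unfold del: weight_simps)
  also have "\<dots> = (\<Sum>i\<in>I. \<Sum>w\<in>?W n. \<rho> i powr s * weight w powr s)"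
    by (subst sum.cartesian_product[symmetric])
      (auto intro!: sum.cong powr_mult simp: rho_pos less_imp_le weight_pos)
  also have "\<dots> = (\<Sum>i\<in>I. \<rho> i powr s) * (\<Sum>w\<in>?W n. weight w powr s)"
    by (simp add: sum_product)
  finally show ?case using Suc by simp
qed

text \<open>The cells of level \<open>n\<close> cover \<open>K\<close> at a cost of at most
  \<open>Q ^ n\<close>, and their weights tend uniformly to 0.\<close>

lemma hausdorff_measure_D:
  assumes s: "0 < s" and lt: "(\<Sum>i\<in>I. \<rho> i powr s) < 1"
  shows "hausdorff_measure s K D = 0"
proof -
  define Q where "Q = (\<Sum>i\<in>I. \<rho> i powr s)"
  have Q: "0 \<le> Q" "Q < 1" using lt by (auto simp: Q_def intro!: sum_nonneg)
  have "(INF U\<in>{U :: nat \<Rightarrow> 'a set. (\<Union>n. U n) = K \<and> (\<forall>n. ediam D (U n) \<le> ennreal \<delta>)}.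
          \<Sum>n. ennreal (enn2real (ediam D (U n)) powr s)) = 0" (is "?L = 0") if d: "0 < \<delta>" for \<delta>
  proof -
    define \<rho>m where "\<rho>m = Max (\<rho> ` I)"
    have rm: "0 < \<rho>m" "\<rho>m < 1" "\<And>i. i \<in> I \<Longrightarrow> \<rho> i \<le> \<rho>m"
      using finI I_ne rho_pos rho_less_1 by (auto simp: \<rho>m_def Max_gr_iff)
    have weight_le: "weight w \<le> \<rho>m ^ length w" if "w \<in> lists I" for w
      using that
    proof (induction w)
      case (Cons i w)
      then show ?case using rm rho_pos[of i] weight_pos[of w] by (auto intro!: mult_mono rm)
    qed auto
    have bound: "?L \<le> ennreal (Q ^ n)" if n: "\<rho>m ^ n \<le> \<delta>" for n
    proof -
      define W where "W = {w \<in> lists I. length w = n}"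
      have finW: "finite W"
        using finite_lists_length_eq[OF finI, of n] by (auto simp: W_def lists_eq_set)
      obtain h where h: "bij_betw h {..<card W} W"
        using ex_bij_betw_nat_finite[OF finW] by (auto simp: atLeast0LessThan)
      \<comment> \<open>The empty sets that fill up the sequence cost nothing: their
        \<open>ediam\<close> is 0, and so is \<open>0 powr s\<close>.\<close>
      define U where "U = (\<lambda>m. if m < card W then cell (h m) else {})"
      have hW: "h m \<in> W" if "m < card W" for m using h that by (auto simp: bij_betw_def)
      have diam: "ediam D (U m) \<le> ennreal (if m < card W then weight (h m) else 0)" for m
      proof (cases "m < card W")
        case True
        then show ?thesis using hW[OF True] by (auto simp: U_def W_def intro!: ediam_le D_cell)
      qed (simp add: U_def ediam_def bot_ennreal)
      have "(\<Union>m. U m) = (\<Union>w\<in>W. cell w)"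
        using h unfolding bij_betw_def U_def by (auto split: if_splits) (metis imageE lessThan_iff)
      also have "\<dots> = K"
      proof
        show "(\<Union>w\<in>W. cell w) \<subseteq> K" using cell_subset_K by (auto simp: W_def)
        show "K \<subseteq> (\<Union>w\<in>W. cell w)"
        proof
          fix x assume "x \<in> K"
          then show "x \<in> (\<Union>w\<in>W. cell w)" using cell_extend_length[of x "[]" n] by (auto simp: W_def)
        qed
      qed
      finally have UK: "(\<Union>m. U m) = K" .
      have "ediam D (U m) \<le> ennreal \<delta>" for m
      proof (rule order_trans[OF diam], rule ennreal_leI)
        show "(if m < card W then weight (h m) else 0) \<le> \<delta>"
          using weight_le[of "h m"] hW[of m] n d by (auto simp: W_def)
      qed
      then have "?L \<le> (\<Sum>m. ennreal (enn2real (ediam D (U m)) powr s))"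
        using UK by (intro INF_lower) auto
      also have "\<dots> = (\<Sum>m<card W. ennreal (enn2real (ediam D (U m)) powr s))"
        by (intro suminf_finite) (auto simp: U_def ediam_def bot_ennreal)
      also have "\<dots> \<le> (\<Sum>m<card W. ennreal (weight (h m) powr s))"
      proof (intro sum_mono ennreal_leI powr_mono2)
        fix m assume m: "m \<in> {..<card W}"
        show "enn2real (ediam D (U m)) \<le> weight (h m)"
          using diam[of m] m weight_pos[of "h m"] hW[of m]
          by (intro enn2real_leI) (auto simp: W_def less_imp_le)
      qed (use s in auto)
      also have "\<dots> = (\<Sum>w\<in>W. ennreal (weight w powr s))"
        using h by (rule sum.reindex_bij_betw)
      also have "\<dots> = ennreal (Q ^ n)"
        using sum_words[of s n] by (simp add: sum_ennreal W_def Q_def)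
      finally show ?thesis .
    qed
    have "eventually (\<lambda>n. \<rho>m ^ n < \<delta>) sequentially"
      using rm d by (intro order_tendstoD(2)[OF LIMSEQ_power_zero]) auto
    then have ev: "eventually (\<lambda>n. ?L \<le> ennreal (Q ^ n)) sequentially"
      by eventually_elim (auto intro: bound)
    have lim: "(\<lambda>n. ennreal (Q ^ n)) \<longlonglongrightarrow> ennreal 0"
      using Q by (intro tendsto_ennrealI LIMSEQ_power_zero) auto
    have "?L \<le> ennreal 0"
      by (rule tendsto_lowerbound[OF lim ev trivial_limit_sequentially])
    then show ?thesis by simp
  qed
  then show ?thesis by (simp add: hausdorff_measure_def)
qed

theorem conformal_dim_le_exponent:
  assumes "0 < s" "(\<Sum>i\<in>I. \<rho> i powr s) < 1"
  shows "conformal_dim K dist \<le> ennreal s"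
proof -
  have "conformal_dim K dist \<le> hausdorff_dim K D"
    unfolding conformal_dim_def qs_equivalent_def
    by (intro Inf_lower CollectI exI[of _ K] exI[of _ D] conjI refl D_metric exI[of _ id] quasisymmetric_D)
  also have "\<dots> \<le> ennreal s"
    unfolding hausdorff_dim_def
    by (intro Inf_lower CollectI exI[of _ s] conjI refl hausdorff_measure_D assms)
  finally show ?thesis .
qed

end

section \<open>Choice of the weight\<close>

text \<open>The sequence is of order n^(1-s); here \<open>s > 1\<close> is decisive.\<close>

lemma mult_powr_tendsto_0:
  fixes s A \<alpha> \<kappa> :: real
  assumes "1 < s" "0 < \<kappa>" "0 < A"
  shows "(\<lambda>n. real n * (A / (\<alpha> + real n * \<kappa>)) powr s) \<longlonglongrightarrow> 0"
  using assms by real_asymp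

context similitude_system
begin

text \<open>Maximality of a cell that misses \<open>P\<close> is expressed through its parent, which
  still meets \<open>P\<close>. Children at level \<open>n\<close> are kept whether they meet
  \<open>P\<close> or not.\<close>

definition refined :: "nat \<Rightarrow> 'i list set" where
  "refined n = {w \<in> lists I. w \<noteq> [] \<and> length w \<le> n \<and> cell (butlast w) \<inter> P \<noteq> {} \<and> (length w = n \<or>
      cell w \<inter> P = {})}"

text \<open>A proper prefix has length below \<open>n\<close>, so its cell misses \<open>P\<close>;
  then the parent of the longer word misses \<open>P\<close> as well.\<close>

lemma refined_parallel:
  assumes "v \<in> refined n" "w \<in> refined n" "v \<noteq> w"
  shows "parallel v w"
proof -
  have no: "\<not> prefix v w" if v: "v \<in> refined n" and w: "w \<in> refined n" and ne: "v \<noteq> w" for v w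
  proof
    assume "prefix v w"
    then obtain u where u: "w = v @ u" "u \<noteq> []" using ne by (auto simp: prefix_def)
    then have "length v < n" using w by (cases u) (auto simp: refined_def)
    then have "cell v \<inter> P = {}" using v by (auto simp: refined_def)
    moreover have "butlast w = v @ butlast u" using u by (simp add: butlast_append)
    moreover have "butlast u \<in> lists I"
      using w u in_set_butlastD by (force simp: refined_def in_lists_conv_set)
    ultimately have "cell (butlast w) \<inter> P = {}" using cell_append_subset[of "butlast u" v] by auto
    then show False using w by (auto simp: refined_def)
  qed
  show ?thesis using no[OF assms] no[OF assms(2,1)] assms(3) by (intro parallelI) auto
qed

lemma refined_cover:
  assumes "P \<noteq> {}" "x \<in> K" "1 \<le> n"
  shows "\<exists>w\<in>refined n. x \<in> cell w"
proof -
  obtain u where u: "u \<in> lists I" "length u = n" "x \<in> cell u"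
    using cell_extend_length[of x "[]" n] assms by auto
  define Q where "Q = (\<lambda>v. prefix v u \<and> v \<noteq> [] \<and> (length v = n \<or> cell v \<inter> P = {}))"
  have "Q u" using u assms by (auto simp: Q_def)
  then obtain v where v: "Q v" and min: "\<And>v'. Q v' \<Longrightarrow> length v \<le> length v'"
    using ex_has_least_nat[of Q u length] by blast
  obtain b where b: "u = v @ b" using v by (auto simp: Q_def prefix_def)
  have "cell (butlast v) \<inter> P \<noteq> {}"
  proof (cases "butlast v = []")
    case True
    then show ?thesis using assms(1) PK by auto
  next
    case False
    have "\<not> Q (butlast v)" using min[of "butlast v"] v
      by (cases v rule: rev_cases) (auto simp: Q_def)
    moreover have "prefix (butlast v) u" using v
      by (auto simp: Q_def intro: prefix_order.trans prefixeq_butlast)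
    ultimately show ?thesis using False by (auto simp: Q_def)
  qed
  then have "v \<in> refined n" using v b u by (auto simp: refined_def Q_def)
  moreover have "x \<in> cell v" using u b cell_append_subset[of b v] by auto
  ultimately show ?thesis by blast
qed

lemma refined_lists: "w \<in> refined n \<Longrightarrow> w \<in> lists I"
  by (simp add: refined_def)

lemma refined_decomp:
  assumes "v \<in> refined n" "w \<in> refined n" "v \<noteq> w"
  obtains t i a j b where "i \<noteq> j" "v = t @ i # a" "w = t @ j # b" "t \<in> lists I" "i \<in> I" "j \<in> I"
    "a \<in> lists I" "b \<in> lists I"
proof -
  obtain t i a j b where "i \<noteq> j" "v = t @ i # a" "w = t @ j # b"
    using parallel_decomp[OF refined_parallel[OF assms]] by blast
  then show ?thesis using that refined_lists[OF assms(1)] refined_lists[OF assms(2)] by auto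
qed

lemma finite_refined: "finite (refined n)"
proof (rule finite_subset)
  show "refined n \<subseteq> {w. set w \<subseteq> I \<and> length w \<le> n}" by (auto simp: refined_def in_lists_conv_set)
  show "finite {w. set w \<subseteq> I \<and> length w \<le> n}" using finite_lists_length_le[OF finI] .
qed

text \<open>Parallel words branch at a letter, so \<open>P_meet_word\<close> and
  \<open>separation_cells\<close> give the conditions with the same \<open>P\<close> and
  \<open>c\<close>.\<close>

lemma refined_system:
  assumes "P \<noteq> {}" "1 \<le> n"
  shows "similitude_system (refined n) (foldr g) ratio K P c"
proof unfold_locales
  show "finite (refined n)" by (rule finite_refined)
  show "K = (\<Union>w\<in>refined n. foldr g w ` K)"
    using refined_cover[OF assms(1) _ assms(2)] cell_subset_K refined_lists
      by (force simp: cell_def)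
  fix w assume w: "w \<in> refined n"
  show "0 < ratio w" using w refined_lists ratio_pos by blast
  show "ratio w < 1"
  proof -
    have "ratio w \<le> rmax ^ length w" using w refined_lists ratio_le_power by blast
    also have "\<dots> \<le> rmax ^ 1" using w rmax(1,2)
      by (intro power_decreasing) (auto simp: refined_def Suc_le_eq)
    finally show ?thesis using rmax(2) by simp
  qed
  show "dist (foldr g w x) (foldr g w y) = ratio w * dist x y" for x y
    using w refined_lists dist_foldr by blast
  show "x \<in> K \<Longrightarrow> foldr g w x \<in> P \<Longrightarrow> x \<in> P" for x using w refined_lists P_back_word by blast
  fix v x y assume v: "v \<in> refined n" "w \<noteq> v"
  then obtain t i a j b where d: "i \<noteq> j" "w = t @ i # a" "v =
      t @ j # b" "t \<in> lists I" "i \<in> I" "j \<in> I"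
    "a \<in> lists I" "b \<in> lists I" using refined_decomp[OF w] by metis
  show "x \<in> K \<Longrightarrow> y \<in> K \<Longrightarrow> foldr g w x = foldr g v y \<Longrightarrow> x \<in> P"
    using P_meet_word[of t i a j b x y] d by auto
  fix z assume z: "z \<in> foldr g w ` K" "z \<in> foldr g v ` K" and x: "x \<in> foldr g w ` K" and y: "y \<in> foldr g v ` K"
  have "cell w \<subseteq> cell (t @ [i])" "cell v \<subseteq> cell (t @ [j])"
    using cell_append_subset[of a "t @ [i]"] cell_append_subset[of b "t @ [j]"] d by auto
  then show "c * dist x z \<le> dist x y"
    using separation_cells[OF d(4,5,6,1), of z x y] x y z by (auto simp: cell_def)
qed (use K_ne K_compact finP PK P_back P_meet c_pos in auto)

text \<open>Such a word is a child of a cell that meets \<open>P\<close> and has level below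
  \<open>n\<close>, and each level has at most \<open>M\<close> of those.\<close>

lemma card_refined:
  assumes M: "\<And>k. card {w \<in> lists I. length w = k \<and> cell w \<inter> P \<noteq> {}} \<le> M"
  shows "card {w \<in> refined n. cell w \<inter> P = {}} \<le> n * (M * card I)"
proof -
  let ?B = "\<lambda>k. {w \<in> lists I. length w = k \<and> cell w \<inter> P \<noteq> {}}"
  have fin: "finite (?B k)" for k
    by (rule finite_subset[OF _ finite_lists_length_eq[OF finI, of k]]) (auto simp: in_lists_conv_set)
  have "{w \<in> refined n. cell w \<inter> P = {}} \<subseteq> (\<lambda>(v, i). v @ [i]) ` ((\<Union>k<n. ?B k) \<times> I)"
  proof
    fix w assume "w \<in> {w \<in> refined n. cell w \<inter> P = {}}"
    then have "w \<in> refined n" by simp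
    moreover then obtain v i where "w = v @ [i]"
      by (cases w rule: rev_cases) (auto simp: refined_def)
    ultimately show "w \<in> (\<lambda>(v, i). v @ [i]) ` ((\<Union>k<n. ?B k) \<times> I)"
      by (intro image_eqI[of _ _ "(v, i)"]) (auto simp: refined_def)
  qed
  then have "card {w \<in> refined n. cell w \<inter> P = {}} \<le> card ((\<Union>k<n. ?B k) \<times> I)"
    using fin finI by (intro surj_card_le) auto
  also have "\<dots> = card (\<Union>k<n. ?B k) * card I" by (simp add: card_cartesian_product)
  also have "\<dots> \<le> (\<Sum>k<n. card (?B k)) * card I" by (intro mult_right_mono card_UN_le) auto
  also have "\<dots> \<le> (\<Sum>k<n. M) * card I" using M by (intro mult_right_mono sum_mono) auto
  finally show ?thesis by (simp add: mult_ac)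
qed

theorem conformal_dim_le:
  assumes M: "\<And>k. card {w \<in> lists I. length w = k \<and> cell w \<inter> P \<noteq> {}} \<le> M"
    and s: "1 < s" and Pne: "P \<noteq> {}"
  shows "conformal_dim K dist \<le> ennreal s"
proof -
  obtain c0 where c0: "c0 > 0" and c0': "\<forall>a\<in>P. \<forall>w\<in>lists I. \<forall>x\<in>cell w. a \<notin> cell w \<longrightarrow>
     (\<exists>u v. w = u @ v \<and> v \<noteq> [] \<and> a \<in> cell u \<and> c0 * ratio u \<le> dist a x)"
    by (rule exE[OF dist_P_cell], erule conjE, rule that)
  \<comment> \<open>With this radius the cutoffs around different points of \<open>P\<close> have
    disjoint supports; the element 1 covers the case of a single point.\<close>
  define \<epsilon>0 where "\<epsilon>0 = Min (insert 1 ((\<lambda>(a, b). dist a b / 2) ` {(a, b) \<in> P \<times> P. a \<noteq> b}))"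
  have fin: "finite ((\<lambda>(a, b). dist a b / 2) ` {(a, b) \<in> P \<times> P. a \<noteq> b})"
    by (intro finite_imageI finite_subset[OF _ finite_cartesian_product[OF finP finP]]) auto
  have e0: "0 < \<epsilon>0" unfolding \<epsilon>0_def using fin by (subst Min_gr_iff) auto
  have e0': "2 * \<epsilon>0 \<le> dist a b" if "a \<in> P" "b \<in> P" "a \<noteq> b" for a b
  proof -
    have "\<epsilon>0 \<le> dist a b / 2" unfolding \<epsilon>0_def using fin that by (intro Min_le) auto
    then show ?thesis by simp
  qed
  \<comment> \<open>A cell that misses \<open>P\<close> has diameter at most
    \<open>diam_bound / c0\<close> times its distance from \<open>a\<close>, so over it the distance
    to \<open>a\<close> varies by at most the factor \<open>B\<close>.\<close>
  define B where "B = 1 + diam_bound / c0"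
  have B: "1 < B" using c0 diam_bound_pos by (simp add: B_def)
  \<comment> \<open>Each of the \<open>card P\<close> cutoffs contributes \<open>ln B / L\<close> to
    the oscillation over such a cell.\<close>
  define A where "A = card P * ln B"
  have "0 < card P" using finP Pne by (simp add: card_gt_0_iff)
  then have A: "0 < A" using B by (simp add: A_def)
  define \<kappa> where "\<kappa> = - ln rmax"
  have kappa: "0 < \<kappa>" using rmax(1,2) by (simp add: \<kappa>_def)
  define \<alpha> where "\<alpha> = ln \<epsilon>0 - ln diam_bound"
  \<comment> \<open>This is \<open>ln (\<epsilon>0 / eps n)\<close>, where \<open>eps n\<close>
    bounds the diameter of cells of level \<open>n\<close>; the linear form exposes its growth in
    \<open>n\<close>.\<close>
  define Lg where "Lg = (\<lambda>n. \<alpha> + real n * \<kappa>)"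
  define eps where "eps = (\<lambda>n. diam_bound * rmax ^ n)"
  have eps_pos: "0 < eps n" for n using diam_bound_pos rmax(1) by (simp add: eps_def)
  have Lg_eq: "Lg n = ln \<epsilon>0 - ln (eps n)" for n
    using diam_bound_pos rmax(1) by (simp add: Lg_def eps_def \<alpha>_def \<kappa>_def ln_mult ln_realpow)
  have lim1: "(\<lambda>n. A / Lg n) \<longlonglongrightarrow> 0" unfolding Lg_def using A kappa by real_asymp
  have lim2: "eps \<longlonglongrightarrow> 0" unfolding eps_def
    using tendsto_mult_left[OF LIMSEQ_power_zero[of rmax], of diam_bound] rmax(1,2) by simp
  \<comment> \<open>An upper bound for the sum of s-th powers: at most \<open>M\<close> cells of
    level \<open>n\<close> meet \<open>P\<close>, and at most \<open>n * (M * card I)\<close> cells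
    miss it.\<close>
  have lim3: "(\<lambda>n. M * (rmax ^ n) powr s + (M * card I) * (real n * (A / Lg n) powr s)) \<longlonglongrightarrow> real M * 0 + real (M * card I) * 0"
  proof (intro tendsto_intros)
    have "(\<lambda>n. (rmax powr s) ^ n) \<longlonglongrightarrow> 0"
    proof (rule LIMSEQ_power_zero)
      have "rmax powr s < 1 powr s" using rmax(1,2) s by (intro powr_less_mono2) auto
      then show "norm (rmax powr s) < 1" by simp
    qed
    moreover have "(rmax powr s) ^ n = (rmax ^ n) powr s" for n
      using rmax(1) by (simp add: powr_realpow[symmetric] powr_powr mult.commute)
    ultimately show "(\<lambda>n. (rmax ^ n) powr s) \<longlonglongrightarrow> 0" by simp
    show "(\<lambda>n. real n * (A / Lg n) powr s) \<longlonglongrightarrow> 0"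
      unfolding Lg_def using mult_powr_tendsto_0[OF s kappa A] .
  qed
  have "eventually (\<lambda>n. 1 \<le> n \<and> A / Lg n < 1 \<and> eps n < \<epsilon>0 \<and>
      M * (rmax ^ n) powr s + (M * card I) * (real n * (A / Lg n) powr s) < 1) sequentially"
    using order_tendstoD(2)[OF lim1, of 1] order_tendstoD(2)[OF lim2 e0] order_tendstoD(2)[OF lim3, of 1]
    by (intro eventually_conj eventually_ge_at_top) auto
  then obtain n where n: "1 \<le> n" "A / Lg n < 1" "eps n < \<epsilon>0"
      "M * (rmax ^ n) powr s + (M * card I) * (real n * (A / Lg n) powr s) < 1"
    using eventually_happens[of _ sequentially] by auto
  define L where "L = Lg n"
  define e where "e = eps n"
  have e: "0 < e" "e < \<epsilon>0" using eps_pos n by (auto simp: e_def)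
  have L: "0 < L" "L = ln \<epsilon>0 - ln e" using e e0 by (auto simp: L_def Lg_eq e_def)
  \<comment> \<open>A logarithmic cutoff: over an annulus \<open>ln (dist x a)\<close> varies by at most \<open>ln B\<close>, and \<open>L\<close> is its
    total variation, of order \<open>n\<close>.\<close>
  define \<theta> where "\<theta> = (\<lambda>(a::'a) x. max 0 ((ln \<epsilon>0 - ln (max (dist x a) e)) / L))"
  define \<rho> where "\<rho> = (\<lambda>w. if cell w \<inter> P \<noteq> {} then ratio w else A / L)"
  have th1: "\<theta> a x = 1" if "dist x a \<le> e" for a x
    using that L by (simp add: \<theta>_def max_def)
  have th0: "\<theta> a x = 0" if "\<epsilon>0 \<le> dist x a" for a x
  proof -
    have "ln \<epsilon>0 \<le> ln (max (dist x a) e)" using that e0 by auto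
    then have "(ln \<epsilon>0 - ln (max (dist x a) e)) / L \<le> 0" using L(1) by (intro divide_nonpos_pos) auto
    then show ?thesis unfolding \<theta>_def by linarith
  qed
  have th_range: "0 \<le> \<theta> a x" "\<theta> a x \<le> 1" for a x
  proof -
    have "ln e \<le> ln (max (dist x a) e)" using e by auto
    then show "\<theta> a x \<le> 1" using L by (auto simp: \<theta>_def)
  qed (simp add: \<theta>_def)
  interpret WS: similitude_system "refined n" "foldr g" ratio K P c
    using refined_system[OF Pne n(1)] .
  obtain p0 where p0: "p0 \<in> P" using Pne by blast
  interpret WW: weighted_system "refined n" "foldr g" ratio K P c \<rho> \<theta> p0
  proof unfold_locales
    show "p0 \<in> P" by (rule p0)
    show "0 < \<rho> w" "\<rho> w < 1" if "w \<in> refined n" for w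
      using WS.r_pos[OF that] WS.r_less_1[OF that] A L n by (auto simp: \<rho>_def L_def)
    show "\<rho> w = ratio w" if "w \<in> refined n" "foldr g w ` K \<inter> P \<noteq> {}" for w
      using that by (simp add: \<rho>_def cell_def)
    show "0 \<le> \<theta> a x" for a x by (rule th_range)
    show "\<theta> a b = (if a = b then 1 else 0)" if "a \<in> P" "b \<in> P" for a b
      using th1[of b a] th0[of b a] e0'[OF that] e e0 by (auto simp: dist_commute)
    show "(\<Sum>a\<in>P. \<theta> a x) \<le> 1" for x
    proof (cases "\<exists>a\<in>P. dist x a < \<epsilon>0")
      case True
      then obtain a where a: "a \<in> P" "dist x a < \<epsilon>0" by blast
      have "\<theta> b x = 0" if "b \<in> P" "b \<noteq> a" for b
      proof (rule th0)
        have "2 * \<epsilon>0 \<le> dist a b" using e0' a that by auto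
        also have "\<dots> \<le> dist x a + dist x b" by (rule dist_triangle3)
        finally show "\<epsilon>0 \<le> dist x b" using a by linarith
      qed
      then have "(\<Sum>b\<in>P. \<theta> b x) = \<theta> a x"
        using a finP by (subst sum.remove[of P a]) auto
      then show ?thesis using th_range by simp
    next
      case False
      then have "(\<Sum>b\<in>P. \<theta> b x) = 0" using th0 by (intro sum.neutral) (auto simp: not_less)
      then show ?thesis by simp
    qed
    fix w x y assume w: "w \<in> refined n" and "x \<in> foldr g w ` K" "y \<in> foldr g w ` K"
    then have xy: "x \<in> cell w" "y \<in> cell w" by (auto simp: cell_def)
    have wl: "w \<in> lists I" using w refined_lists by blast
    show "(\<Sum>a\<in>P. \<bar>\<theta> a x - \<theta> a y\<bar>) \<le> \<rho> w"
    proof (cases "cell w \<inter> P \<noteq> {}")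
      \<comment> \<open>The cell has level \<open>n\<close>, so it lies where the cutoff of
        \<open>b\<close> is 1 and all others are 0, and the oscillation vanishes.\<close>
      case True
      then obtain b where b: "b \<in> P" "b \<in> cell w" by blast
      have len: "length w = n" using w True by (auto simp: refined_def)
      have near: "dist z b \<le> e" if "z \<in> cell w" for z
      proof -
        have "dist z b \<le> diam_bound * ratio w" using dist_cell[OF wl that b(2)] .
        also have "\<dots> \<le> e" unfolding e_def eps_def using ratio_le_power[OF wl] len diam_bound_pos
          by (intro mult_left_mono) auto
        finally show ?thesis .
      qed
      have "\<theta> a z = (if a = b then 1 else 0)" if "z \<in> cell w" "a \<in> P" for a z
      proof (cases "a = b")
        case True
        then show ?thesis using th1 near[OF that(1)] by simp
      next
        case False
        have "2 * \<epsilon>0 \<le> dist z a + dist z b"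
          using e0'[OF that(2) b(1) False] dist_triangle3[of a b z] by linarith
        then have "\<epsilon>0 \<le> dist z a" using near[OF that(1)] e by linarith
        then show ?thesis using th0 False by simp
      qed
      then have "(\<Sum>a\<in>P. \<bar>\<theta> a x - \<theta> a y\<bar>) = 0" using xy by (intro sum.neutral) auto
      then show ?thesis using WS.r_pos[OF w] True by (simp add: \<rho>_def)
    next
      case False
      have diff: "\<theta> a x - \<theta> a y \<le>
          ln B / L" if a: "a \<in> P" and x: "x \<in> cell w" and y: "y \<in> cell w" for a x y
      proof -
        have "a \<notin> cell w" using False a by blast
        then obtain u v where uv: "w = u @ v" "c0 * ratio u \<le> dist a x" using c0' a wl x by blast
        have "ratio w \<le> ratio u" using uv wl ratio_le_1[of v] ratio_pos[of u]
          by (simp add: mult_left_le)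
        then have "c0 * ratio w \<le> dist x a" using uv c0 by (smt (verit) mult_left_mono dist_commute)
        then have ratio: "ratio w \<le> dist x a / c0" using c0 by (simp add: field_simps)
        have "dist x y \<le> diam_bound * ratio w" using dist_cell[OF wl x y] .
        also have "\<dots> \<le> diam_bound * (dist x a / c0)" using ratio diam_bound_pos
          by (intro mult_left_mono) auto
        finally have "dist y a \<le> B * dist x a"
          using dist_triangle3[of y a x] by (simp add: B_def distrib_right)
        also have "\<dots> \<le> B * max (dist x a) e" using B by (intro mult_left_mono) auto
        finally have "dist y a \<le> B * max (dist x a) e" .
        moreover have "e \<le> B * max (dist x a) e"
        proof -
          have "1 * e \<le> B * max (dist x a) e" using B e by (intro mult_mono) auto
          then show ?thesis by simp
        qed
        ultimately have "max (dist y a) e \<le> B * max (dist x a) e" by simp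
        moreover have pos: "0 < max (dist y a) e" "0 < max (dist x a) e" using e by auto
        ultimately have "ln (max (dist y a) e) \<le> ln (B * max (dist x a) e)" using B
          by (subst ln_le_cancel_iff) auto
        also have "\<dots> = ln B + ln (max (dist x a) e)" using B pos by (simp add: ln_mult)
        finally have "(ln \<epsilon>0 - ln (max (dist x a) e)) / L \<le>
            (ln B + (ln \<epsilon>0 - ln (max (dist y a) e))) / L"
          using L(1) by (intro divide_right_mono) auto
        then have "(ln \<epsilon>0 - ln (max (dist x a) e)) / L \<le>
            ln B / L + (ln \<epsilon>0 - ln (max (dist y a) e)) / L"
          by (simp only: add_divide_distrib)
        moreover have "0 \<le> ln B / L" using B L by simp
        ultimately show ?thesis unfolding \<theta>_def by linarith
      qed
      have "\<bar>\<theta> a x - \<theta> a y\<bar> \<le> ln B / L" if "a \<in> P" for a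
        using diff[OF that xy] diff[OF that xy(2,1)] by linarith
      then have "(\<Sum>a\<in>P. \<bar>\<theta> a x - \<theta> a y\<bar>) \<le> (\<Sum>a\<in>P. ln B / L)" by (intro sum_mono)
      then show ?thesis using False by (simp add: \<rho>_def A_def)
    qed
  qed
  let ?B = "{w \<in> lists I. length w = n \<and> cell w \<inter> P \<noteq> {}}"
  let ?C = "{w \<in> refined n. cell w \<inter> P = {}}"
  have finB: "finite ?B"
    by (rule finite_subset[OF _ finite_lists_length_eq[OF finI, of n]]) (auto simp: in_lists_conv_set)
  have finC: "finite ?C" using finite_refined[of n] by auto
  have "(\<Sum>w\<in>refined n. \<rho> w powr s) \<le> (\<Sum>w\<in>?B \<union> ?C. \<rho> w powr s)"
    using finB finC by (intro sum_mono2) (auto simp: refined_def)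
  also have "\<dots> = (\<Sum>w\<in>?B. ratio w powr s) + (\<Sum>w\<in>?C. (A / L) powr s)"
    using finB finC by (subst sum.union_disjoint) (auto simp: \<rho>_def intro!: sum.cong)
  also have "\<dots> \<le> (\<Sum>w\<in>?B. (rmax ^ n) powr s) + (\<Sum>w\<in>?C. (A / L) powr s)"
  proof (intro add_mono sum_mono powr_mono2)
    fix w assume w: "w \<in> ?B"
    then show "0 \<le> ratio w" "ratio w \<le> rmax ^ n" using ratio_pos[of w] ratio_le_power[of w]
      by (auto simp: less_imp_le)
  qed (use s A L(1) in auto)
  also have "\<dots> = card ?B * (rmax ^ n) powr s + card ?C * (A / L) powr s" by simp
  also have "\<dots> \<le> M * (rmax ^ n) powr s + real (n * (M * card I)) * (A / L) powr s"
    using M[of n] card_refined[OF M, of n] by (intro add_mono mult_right_mono of_nat_mono) auto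
  also have "\<dots> = M * (rmax ^ n) powr s + (M * card I) * (real n * (A / Lg n) powr s)"
    by (simp add: L_def)
  also have "\<dots> < 1" by (rule n)
  finally have lt: "(\<Sum>w\<in>refined n. \<rho> w powr s) < 1" .
  have "0 < s" using s by simp
  from WW.conformal_dim_le_exponent[OF this lt] show ?thesis .
qed

end

section \<open>The lower bound\<close>

lemma hausdorff_dim_ge_1:
  assumes Y: "Metric_space Y d" and conn: "connected_space (Metric_space.mtopology Y d)"
    and ab: "a \<in> Y" "b \<in> Y" "a \<noteq> b"
  shows "1 \<le> hausdorff_dim Y d"
proof -
  interpret Metric_space Y d by fact
  have "1 \<le> s" if s: "0 < s" and zero: "hausdorff_measure s Y d = 0" for s
  proof (rule ccontr)
    assume "\<not> 1 \<le> s"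
    define D0 where "D0 = d a b"
    have D0: "0 < D0" using ab mdist_pos_eq by (simp add: D0_def)
    \<comment> \<open>Diameters at most 1 are required so that
      \<open>\<delta> n \<le> \<delta> n powr s\<close> for \<open>s < 1\<close>.\<close>
    have "(INF U\<in>{U :: nat \<Rightarrow> 'a set. (\<Union>n. U n) = Y \<and> (\<forall>n. ediam d (U n) \<le> ennreal 1)}.
          \<Sum>n. ennreal (enn2real (ediam d (U n)) powr s)) \<le> hausdorff_measure s Y d"
      unfolding hausdorff_measure_def by (rule SUP_upper) simp
    \<comment> \<open>Half of \<open>D0\<close>, because the intervals below have length
      \<open>2 * \<delta> n\<close>.\<close>
    also have "\<dots> < ennreal (D0 / 2)" using zero D0 by simp
    finally obtain U :: "nat \<Rightarrow> 'a set" where U: "(\<Union>n. U n) = Y" "\<And>n. ediam d (U n) \<le> 1"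
        and sum: "(\<Sum>n. ennreal (enn2real (ediam d (U n)) powr s)) < ennreal (D0 / 2)"
      by (auto simp: INF_less_iff)
    define \<delta> where "\<delta> = (\<lambda>n. enn2real (ediam d (U n)))"
    have delta: "0 \<le> \<delta> n" "\<delta> n \<le> 1" for n
      using U(2)[of n] by (auto simp: \<delta>_def intro: enn2real_leI)
    have dU: "d x y \<le> \<delta> n" if "x \<in> U n" "y \<in> U n" for x y n
    proof -
      have "ennreal (d x y) \<le> ediam d (U n)"
        unfolding ediam_def using that by (intro SUP_upper2[of x] SUP_upper2[of y]) auto
      moreover have "ediam d (U n) < top" using U(2)[of n] by (rule le_less_trans) simp
      ultimately show ?thesis unfolding \<delta>_def
        using enn2real_mono[of "ennreal (d x y)" "ediam d (U n)"] by simp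
    qed
    have delta_s: "\<delta> n \<le> \<delta> n powr s" for n
    proof (cases "\<delta> n = 0")
      case False
      then have "\<delta> n powr 1 \<le> \<delta> n powr s"
        using delta[of n] \<open>\<not> 1 \<le> s\<close> by (intro powr_mono') auto
      then show ?thesis using delta[of n] by simp
    qed simp
    have cont: "continuous_map mtopology euclideanreal (d a)"
      unfolding continuous_map_def
    proof (intro conjI allI impI)
      fix V :: "real set" assume "openin euclideanreal V"
      then have V: "open V" by simp
      show "openin mtopology {x \<in> topspace mtopology. d a x \<in> V}"
        unfolding openin_mtopology
      proof (intro conjI allI impI)
        fix x assume x: "x \<in> {x \<in> topspace mtopology. d a x \<in> V}"
        then obtain e where e: "e > 0" "ball (d a x) e \<subseteq> V" using V open_contains_ball by blast
        have "\<bar>d a x - d a y\<bar> \<le> d x y" if "y \<in> Y" for y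
          using triangle[of a x y] triangle[of a y x] commute[of x y] x that ab by auto
        then have "mball x e \<subseteq> {x \<in> topspace mtopology. d a x \<in> V}"
          using e by (force simp: dist_real_def)
        then show "\<exists>r>0. mball x r \<subseteq> {x \<in> topspace mtopology. d a x \<in> V}" using e by blast
      qed auto
    qed auto
    have "connectedin euclideanreal (d a ` Y)"
      using connectedin_continuous_map_image[OF cont, of Y] conn by (simp add: connectedin_def)
    then have connS: "connected (d a ` Y)" by simp
    have "0 \<in> d a ` Y" using ab by (auto intro!: image_eqI[of _ _ a])
    moreover have "D0 \<in> d a ` Y" using ab by (auto simp: D0_def)
    ultimately have sub: "{0..D0} \<subseteq> d a ` Y" using connS by (intro connected_contains_Icc)
    \<comment> \<open>The image of \<open>U n\<close> need not be measurable; an interval around the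
      value at one of its points contains it.\<close>
    define V where "V = (\<lambda>n. if U n =
        {} then {} else {d a (SOME x. x \<in> U n) - \<delta> n .. d a (SOME x. x \<in> U n) + \<delta> n})"
    have "d a ` Y \<subseteq> (\<Union>n. V n)"
    proof
      fix t assume "t \<in> d a ` Y"
      then obtain x n where x: "x \<in> U n" "t = d a x" using U(1) by blast
      define p where "p = (SOME x. x \<in> U n)"
      have p: "p \<in> U n" unfolding p_def using x by (metis someI)
      have "x \<in> Y" "p \<in> Y" unfolding U(1)[symmetric] using x p by auto
      then have "d a x \<le> d a p + d p x" "d a p \<le> d a x + d x p" using triangle ab(1) by auto
      then have "t \<in> V n" using dU[OF x(1) p] dU[OF p x(1)] x by (auto simp: V_def simp flip: p_def)
      then show "t \<in> (\<Union>n. V n)" by blast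
    qed
    then have sub': "{0..D0} \<subseteq> (\<Union>n. V n)" by (rule order_trans[OF sub])
    have V: "V n \<in> sets lborel" "emeasure lborel (V n) \<le> ennreal (2 * \<delta> n)" for n
      using delta[of n] by (auto simp: V_def)
    have "ennreal D0 = emeasure lborel {0..D0}" using D0 by simp
    also have "\<dots> \<le> emeasure lborel (\<Union>n. V n)" using sub' V by (intro emeasure_mono) auto
    also have "\<dots> \<le> (\<Sum>n. emeasure lborel (V n))" using V
      by (intro emeasure_subadditive_countably) auto
    also have "\<dots> \<le> (\<Sum>n. ennreal 2 * ennreal (\<delta> n powr s))"
    proof (intro suminf_le)
      fix n
      have "emeasure lborel (V n) \<le> ennreal (2 * \<delta> n)" by (rule V)
      also have "\<dots> \<le> ennreal (2 * \<delta> n powr s)" using delta_s by (intro ennreal_leI) auto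
      finally show "emeasure lborel (V n) \<le> ennreal 2 * ennreal (\<delta> n powr s)"
        by (simp add: ennreal_mult)
    qed auto
    also have "\<dots> = ennreal 2 * (\<Sum>n. ennreal (\<delta> n powr s))" by simp
    also have "\<dots> < ennreal 2 * ennreal (D0 / 2)"
      using sum by (intro ennreal_mult_strict_left_mono) (auto simp: \<delta>_def)
    also have "\<dots> = ennreal (2 * (D0 / 2))" using D0 by (intro ennreal_mult[symmetric]) auto
    also have "\<dots> = ennreal D0" by simp
    finally show False by simp
  qed
  then show ?thesis unfolding hausdorff_dim_def
    by (intro Inf_greatest) (auto simp flip: ennreal_1 intro!: ennreal_leI)
qed

lemma conformal_dim_ge_1:
  fixes K :: "'a::metric_space set"
  assumes K: "connected K" and ab: "a \<in> K" "b \<in> K" "a \<noteq> b"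
  shows "1 \<le> conformal_dim K dist"
  unfolding conformal_dim_def
proof (rule Inf_greatest)
  fix v assume "v \<in> {hausdorff_dim Y dY |(Y :: 'a set) dY. Metric_space Y dY \<and>
      qs_equivalent K dist Y dY}"
  then obtain Y :: "'a set" and dY h where Y: "Metric_space Y dY" "v = hausdorff_dim Y dY"
      and h: "homeomorphic_map (Metric_space.mtopology K dist) (Metric_space.mtopology Y dY) h"
    by (auto simp: qs_equivalent_def quasisymmetric_def)
  interpret S: Submetric UNIV dist K by unfold_locales auto
  interpret Y: Metric_space Y dY by fact
  have "connectedin euclidean K" using K by simp
  then have "connected_space S.sub.mtopology"
    by (simp add: S.mtopology_submetric connectedin_def)
  then have "connected_space Y.mtopology"
    using homeomorphic_connected_space[OF homeomorphic_map_imp_homeomorphic_space[OF h]] by blast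
  moreover have "h a \<in> Y" "h b \<in> Y"
    using homeomorphic_imp_surjective_map[OF h] ab by auto
  moreover have "h a \<noteq> h b"
    using homeomorphic_imp_injective_map[OF h] ab by (auto simp: inj_on_def)
  ultimately show "1 \<le> v" using hausdorff_dim_ge_1[OF Y(1)] Y(2) by blast
qed

section \<open>Post-critically finite systems\<close>

text \<open>Excludes a one-point attractor, for which every code would be mapped into
  \<open>P\<close>.\<close>

lemma infinite_codes:
  assumes "2 \<le> N"
  shows "infinite (codes N)"
proof
  assume "finite (codes N)"
  moreover have "range (\<lambda>k n. if n = k then 1 else 2) \<subseteq> codes N"
    using assms by (auto simp: codes_def)
  ultimately have "finite (range (\<lambda>k n :: nat. if n = k then 1 else 2 :: nat))"
    by (rule rev_finite_subset)
  moreover have "inj (\<lambda>k n :: nat. if n = k then 1 else 2 :: nat)"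
  proof (rule injI)
    fix k l :: nat assume "(\<lambda>n. if n = k then 1 else 2 :: nat) = (\<lambda>n. if n = l then 1 else 2)"
    then have "(if k = k then 1 else 2 :: nat) = (if k = l then 1 else 2)" by (rule fun_cong)
    then show "k = l" by (simp split: if_splits)
  qed
  ultimately show False using finite_imageD infinite_UNIV_nat by blast
qed

text \<open>Two maps at least, since a single contraction has a one-point attractor, of conformal
  dimension 0.\<close>

theorem theorem1p3:
  fixes f :: "nat \<Rightarrow> 'a::complete_space \<Rightarrow> 'a" and N :: nat and K :: "'a set"
  assumes "2 \<le> N"
    and "self_similar_ifs N f"
    and "is_attractor N f K"
    and "post_critically_finite N f K"
    and "dendrite K"
    and "angle_separation N f K"
  shows "conformal_dim K dist = 1"
proof -
  define I where "I = {1..N}"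
  define P where "P = post_critical_set N f K"
  define S where "S = {s \<in> codes N. coding_map f K s \<in> P}"
  have finS: "finite S" using assms(4) by (simp add: post_critically_finite_def S_def P_def)
  have "\<forall>i\<in>I. \<exists>r. 0 < r \<and> r < 1 \<and> (\<forall>x y. dist (f i x) (f i y) = r * dist x y)"
    using assms(2) by (simp add: self_similar_ifs_def contractive_similitude_def I_def)
  then obtain r where r: "\<And>i. i \<in> I \<Longrightarrow>
      0 < r i \<and> r i < 1 \<and> (\<forall>x y. dist (f i x) (f i y) = r i * dist x y)"
    by metis
  have K: "K \<noteq> {}" "compact K" "K = (\<Union>i\<in>I. f i ` K)"
    using assms(3) by (simp_all add: is_attractor_def I_def)
  interpret A: similitude_ifs I f r K
    using r K by unfold_locales (simp_all add: I_def)
  have code: "coding_map f K s = x" if "\<And>n. s n \<in> I" "\<And>k. x \<in> A.cell (map s [0..<k])" for s x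
    using A.INT_cells_code[OF that] by (simp add: coding_map_def A.cell_def)
  have codes: "s \<in> codes N \<longleftrightarrow> (\<forall>n. s n \<in> I)" for s by (simp add: codes_def I_def)
  have wordsI: "w \<in> words N \<longleftrightarrow> w \<noteq> [] \<and> w \<in> lists I" for w
    by (auto simp: words_def I_def in_lists_conv_set)
  have P_iff: "x \<in> P \<longleftrightarrow> x \<in> K \<and> (\<exists>w\<in>words N. foldr f w x \<in> critical_set N f K)" for x
    by (auto simp: P_def post_critical_set_def)
  have critical: "f i x \<in> critical_set N f K" if "i \<in> I" "j \<in> I" "i \<noteq> j" "x \<in> K" "y \<in> K" "f i x =
      f j y" for i j x y
  proof -
    have "f i x \<in> f i ` K" "f i x \<in> f j ` K"
      using imageI[OF that(4), of "f i"] imageI[OF that(5), of "f j"] that(6)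
      by simp_all
    then show ?thesis using that(1-3) unfolding critical_set_def I_def by blast
  qed
  have PI: "x \<in> P" if "i \<in> I" "x \<in> K" "f i x \<in> critical_set N f K" for i x
    unfolding P_iff using that by (auto simp: wordsI intro!: bexI[of _ "[i]"])
  \<comment> \<open>Every point of \<open>K\<close> has a code, so finiteness passes from the codes
    to \<open>P\<close>.\<close>
  have PS: "P \<subseteq> coding_map f K ` S"
  proof
    fix x assume x: "x \<in> P"
    then have "x \<in> A.cell []" by (simp add: P_iff)
    then obtain s where s: "\<And>n. s n \<in> I" "\<And>k. x \<in> A.cell (map s [0..<k])"
      using A.code_exists[of x "[]"] by auto
    then have "coding_map f K s = x" by (rule code)
    then show "x \<in> coding_map f K ` S" using s x by (auto simp: S_def codes)
  qed
  obtain c where c: "c > 0" and asc: "\<And>i j x y z. i \<in> I \<Longrightarrow> j \<in> I \<Longrightarrow> i \<noteq> j \<Longrightarrow> f i ` K \<inter> f j ` K = {z} \<Longrightarrow>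
      x \<in> f i ` K \<Longrightarrow> y \<in> f j ` K \<Longrightarrow> c * max (dist x z) (dist y z) \<le> dist x y"
    using assms(6) unfolding angle_separation_def I_def by metis
  interpret B: similitude_system I f r K P c
  proof
    show "finite P" using PS finS finite_surj by blast
    show "P \<subseteq> K" by (auto simp: P_iff)
    show "0 < c" by (rule c)
    fix i assume i: "i \<in> I"
    show "x \<in> P" if x: "x \<in> K" "f i x \<in> P" for x
    proof -
      obtain w where "w \<in> words N" "foldr f w (f i x) \<in> critical_set N f K" using x P_iff by blast
      then show ?thesis using x i unfolding P_iff
        by (auto simp: wordsI intro!: bexI[of _ "w @ [i]"])
    qed
    fix j assume j: "j \<in> I" "i \<noteq> j"
    show "x \<in> P" if "x \<in> K" "y \<in> K" "f i x = f j y" for x y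
      using PI[OF i that(1)] critical[OF i j that] by blast
    fix x y z assume z: "z \<in> f i ` K" "z \<in> f j ` K" and xy: "x \<in> f i ` K" "y \<in> f j ` K"
    have "f i ` K \<inter> f j ` K = {} \<or> (\<exists>z. f i ` K \<inter> f j ` K = {z})"
      using assms(6) i j by (auto simp: angle_separation_def single_intersection_def I_def)
    then obtain z' where z': "f i ` K \<inter> f j ` K = {z'}" using z by auto
    then have "z = z'" using z by blast
    then have "f i ` K \<inter> f j ` K = {z}" using z' by simp
    then have "c * max (dist x z) (dist y z) \<le> dist x y" using asc i j xy by blast
    moreover have "c * dist x z \<le> c * max (dist x z) (dist y z)" using c
      by (intro mult_left_mono) auto
    ultimately show "c * dist x z \<le> dist x y" by linarith
  qed
  \<comment> \<open>Each such word begins a code of a point of \<open>P\<close> and is recovered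
    from it, so the bound does not depend on \<open>k\<close>.\<close>
  have M: "card {w \<in> lists I. length w = k \<and> A.cell w \<inter> P \<noteq> {}} \<le> card S" for k
  proof (rule surj_card_le[OF finS])
    show "{w \<in> lists I. length w = k \<and> A.cell w \<inter> P \<noteq> {}} \<subseteq> (\<lambda>s. map s [0..<k]) ` S"
    proof
      fix w assume "w \<in> {w \<in> lists I. length w = k \<and> A.cell w \<inter> P \<noteq> {}}"
      then obtain x where w: "w \<in> lists I" "length w = k" "x \<in> A.cell w" "x \<in> P" by blast
      obtain s where s: "\<And>n. s n \<in> I" "map s [0..<length w] = w" "\<And>k. x \<in> A.cell (map s [0..<k])"
        using A.code_exists[OF w(3,1)] by blast
      have "coding_map f K s = x" using s(1,3) by (rule code)
      then show "w \<in> (\<lambda>s. map s [0..<k]) ` S" using s w by (auto simp: S_def codes)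
    qed
  qed
  have N: "1 \<in> I" "2 \<in> I" using assms(1) by (auto simp: I_def)
  have conn: "connected K" using assms(5) by (simp add: dendrite_def)
  \<comment> \<open>Otherwise the first level cells are closed and pairwise disjoint, and one of
    them against the union of the others disconnects \<open>K\<close>.\<close>
  have "P \<noteq> {}"
  proof
    assume "P = {}"
    then have disj: "f i ` K \<inter> f j ` K = {}" if "i \<in> I" "j \<in> I" "i \<noteq> j" for i j
      using B.P_meet[of i j] that by blast
    have cl: "closed (f i ` K)" if "i \<in> I" for i
      using A.cell_compact[of "[i]"] that by (auto simp: A.cell_def intro: compact_imp_closed)
    define U where "U = (\<Union>j\<in>I - {1}. f j ` K)"
    have 1: "closed U" unfolding U_def using cl by (intro closed_UN) (auto simp: I_def)
    have 2: "closed (f 1 ` K)" using cl N by blast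
    have 3: "K \<subseteq> f 1 ` K \<union> U" using K(3) by (auto simp: U_def)
    have 4: "f 1 ` K \<inter> U \<inter> K = {}" using disj[OF N(1)] by (auto simp: U_def)
    have 5: "f 1 ` K \<inter> K \<noteq> {}" using K(1) A.g_in_K[OF N(1)] by blast
    have "f 2 ` K \<subseteq> U" using N by (auto simp: U_def)
    then have 6: "U \<inter> K \<noteq> {}" using K(1) A.g_in_K[OF N(2)] by blast
    show False using connected_closedD[OF conn 4 3 2 1] 5 6 by simp
  qed
  \<comment> \<open>If \<open>K\<close> were a single point, that point would lie in
    \<open>P\<close> and the finite set \<open>S\<close> would contain all codes.\<close>
  have "\<exists>a\<in>K. \<exists>b\<in>K. a \<noteq> b"
  proof (rule ccontr)
    assume "\<not> ?thesis"
    then have no: "x = y" if "x \<in> K" "y \<in> K" for x y using that by blast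
    obtain z where z: "z \<in> K" using K(1) by blast
    have "s \<in> S" if "s \<in> codes N" for s
    proof -
      have w: "map s [0..<k] \<in> lists I" for k using that by (auto simp: codes in_lists_conv_set)
      have "z \<in> A.cell (map s [0..<k])" for k
      proof -
        have "foldr f (map s [0..<k]) z \<in> K" using A.foldr_in_K[OF w z] .
        then have "foldr f (map s [0..<k]) z = z" using no z by blast
        then show ?thesis using A.foldr_in_cell[OF z, of "map s [0..<k]"] by simp
      qed
      then have "coding_map f K s = z" using that by (intro code) (auto simp: codes)
      moreover have "z \<in> P" using \<open>P \<noteq> {}\<close> B.PK z no by blast
      ultimately show ?thesis using that by (simp add: S_def)
    qed
    then have "codes N \<subseteq> S" by blast
    then show False using finS infinite_codes[OF assms(1)] finite_subset by blast
  qed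
  then obtain a b where ab: "a \<in> K" "b \<in> K" "a \<noteq> b" by blast
  have "conformal_dim K dist \<le> 1"
  proof (rule ennreal_le_epsilon)
    fix e :: real assume "0 < e"
    then have "conformal_dim K dist \<le> ennreal (1 + e)"
      by (intro B.conformal_dim_le[OF M _ \<open>P \<noteq> {}\<close>]) simp
    also have "ennreal (1 + e) = ennreal 1 + ennreal e" using \<open>0 < e\<close> by (intro ennreal_plus) auto
    finally show "conformal_dim K dist \<le> 1 + ennreal e" by simp
  qed
  moreover have "1 \<le> conformal_dim K dist" using conformal_dim_ge_1[OF conn ab] .
  ultimately show ?thesis by (rule antisym)
qed

end
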